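(* Let $\widehat{\mathcal Z}=[\hat X_1,\hat Y_1,\dots,\hat X_p,\hat Y_p]$, with $\hat X_k,\hat Y_k\in\mathbb R^{m\times n}$, be an approximate solution of the PGCS equation $A_kX_k-Y_kB_k=E_k$, $C_kX_{k+1}-Y_kD_k=F_k$ ($k=1,\dots,p$, $X_{p+1}=X_1$), and let $\alpha_k,\beta_k,\gamma_k,\zeta_k,\tau_k,\delta_k>0$ ($k=1,\dots,p$) be given tolerances. Then the normwise backward error $\eta(\widehat{\mathcal Z})$ satisfies $$\frac{\|\widehat H^{\dagger}r\|_2}{\sqrt{6p}}\le \eta(\widehat{\mathcal Z})\le \|\widehat H^{\dagger}r\|_2,$$ where $\widehat H$, $r$ and $\eta(\widehat{\mathcal Z})$ are as defined in the context.
   Context: Setting: $p,m,n\ge 1$ are integers, and $A_k,C_k\in\mathbb R^{m\times m}$, $B_k,D_k\in\mathbb R^{n\times n}$, $E_k,F_k\in\mathbb R^{m\times n}$ ($k=1,\dots,p$) are given. The periodic generalized coupled Sylvester (PGCS) equation is the system $A_kX_k-Y_kB_k=E_k$, $C_kX_{k+1}-Y_kD_k=F_k$, $k=1,\dots,p$, with unknowns $X_k,Y_k\in\mathbb R^{m\times n}$ and $X_{p+1}=X_1$. Put $\hat X_{p+1}=\hat X_1$. Backward error: $\eta(\widehat{\mathcal Z})$ is the minimum of all $\epsilon\ge 0$ for which there exist $\Delta A_k,\Delta C_k\in\mathbb R^{m\times m}$, $\Delta B_k,\Delta D_k\in\mathbb R^{n\times n}$, $\Delta E_k,\Delta F_k\in\mathbb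 R^{m\times n}$ ($k=1,\dots,p$) such that, for all $k$, $$(A_k+\Delta A_k)\hat X_k-\hat Y_k(B_k+\Delta B_k)=E_k+\Delta E_k,\qquad (C_k+\Delta C_k)\hat X_{k+1}-\hat Y_k(D_k+\Delta D_k)=F_k+\Delta F_k,$$ and $\|\Delta A_k\|_F\le\epsilon\alpha_k$, $\|\Delta B_k\|_F\le\epsilon\beta_k$, $\|\Delta E_k\|_F\le\epsilon\gamma_k$, $\|\Delta C_k\|_F\le\epsilon\zeta_k$, $\|\Delta D_k\|_F\le\epsilon\tau_k$, $\|\Delta F_k\|_F\le\epsilon\delta_k$. Notation: $\otimes$ is the Kronecker product, $\mathrm{vec}$ stacks the columns of a matrix one underneath the other, $I$ is an identity matrix of appropriate order, $M^\dagger$ is the Moore-Penrose inverse, $\|\cdot\|_F$ the Frobenius norm, $\|\cdot\|_2$ the Euclidean norm. Residuals: $R_{k1}=E_k-(A_k\hat X_k-\hat Y_kB_k)$, $R_{k2}=F_k-(C_k\hat X_{k+1}-\hat Y_kD_k)$, and $r=\mathrm{vec}([R_{11},R_{12},R_{21},R_{22},\dots,R_{p1},R_{p2}])$. The matrix $\widehat H=\mathrm{diag}(\widehat H_1,\dots,\widehat H_p)$ is block diagonal with $$\widehat H_k=\begin{bmatrix}\alpha_k(\hat X_k^T\otimes I)&-\beta_k(I\otimes\hat Y_k)&-\gamma_kI&0&0&0\\0&0&0&\zeta_k(\hat X_{k+1}^T\otimes I)&-\tau_k(I\otimes\hat Y_k)&-\delta_kI\end{bmatrix}.$$ *)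

theory Defs
  imports Complex_Main "Jordan_Normal_Form.Matrix"
begin

definition frob_norm :: "real mat \<Rightarrow> real" where
  "frob_norm A = sqrt (\<Sum>i<dim_row A. \<Sum>j<dim_col A. (A $$ (i, j))\<^sup>2)"

definition eucl_norm :: "real vec \<Rightarrow> real" where
  "eucl_norm v = sqrt (\<Sum>i<dim_vec v. (v $ i)\<^sup>2)"

definition kronecker :: "real mat \<Rightarrow> real mat \<Rightarrow> real mat" where
  "kronecker A B = mat (dim_row A * dim_row B) (dim_col A * dim_col B)
     (\<lambda>(i, j). A $$ (i div dim_row B, j div dim_col B) * B $$ (i mod dim_row B, j mod dim_col B))"

(* Columns stacked one underneath the other: entry (a, b) of A goes to position b * dim_row A + a. *)
definition vectorize :: "real mat \<Rightarrow> real vec" where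
  "vectorize A = vec (dim_row A * dim_col A) (\<lambda>i. A $$ (i mod dim_row A, i div dim_row A))"

definition append_cols :: "real mat \<Rightarrow> real mat \<Rightarrow> real mat" where
  "append_cols A B = four_block_mat A B (0\<^sub>m 0 (dim_col A)) (0\<^sub>m 0 (dim_col B))"

(* The row of blocks [A1, A2, ...]; nr is the common number of rows. *)
definition block_row :: "nat \<Rightarrow> real mat list \<Rightarrow> real mat" where
  "block_row nr As = foldr append_cols As (0\<^sub>m nr 0)"

(* The four Penrose conditions. *)
definition is_moore_penrose_inverse :: "real mat \<Rightarrow> real mat \<Rightarrow> bool" where
  "is_moore_penrose_inverse M P \<longleftrightarrow>
     P \<in> carrier_mat (dim_col M) (dim_row M) \<and>
     M * P * M = M \<and> P * M * P = P \<and>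
     transpose_mat (M * P) = M * P \<and> transpose_mat (P * M) = P * M"

definition moore_penrose_inverse :: "real mat \<Rightarrow> real mat" where
  "moore_penrose_inverse M = (THE P. is_moore_penrose_inverse M P)"

(* All families are indexed by k = 1, ..., p; the definitions below read the approximate
   solution X also at k = p + 1, where the theorem assumes X (p + 1) = X 1. *)

definition backward_error_feasible ::
  "nat \<Rightarrow> nat \<Rightarrow> nat \<Rightarrow>
   (nat \<Rightarrow> real mat) \<Rightarrow> (nat \<Rightarrow> real mat) \<Rightarrow> (nat \<Rightarrow> real mat) \<Rightarrow>
   (nat \<Rightarrow> real mat) \<Rightarrow> (nat \<Rightarrow> real mat) \<Rightarrow> (nat \<Rightarrow> real mat) \<Rightarrow>
   (nat \<Rightarrow> real) \<Rightarrow> (nat \<Rightarrow> real) \<Rightarrow> (nat \<Rightarrow> real) \<Rightarrow>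
   (nat \<Rightarrow> real) \<Rightarrow> (nat \<Rightarrow> real) \<Rightarrow> (nat \<Rightarrow> real) \<Rightarrow>
   (nat \<Rightarrow> real mat) \<Rightarrow> (nat \<Rightarrow> real mat) \<Rightarrow> real \<Rightarrow> bool" where
  "backward_error_feasible p m n A B C D E F \<alpha> \<beta> \<gamma> \<zeta> \<tau> \<delta> X Y \<epsilon> \<longleftrightarrow>
     0 \<le> \<epsilon> \<and>
     (\<exists>dA dB dC dD dE dF. \<forall>k\<in>{1..p}.
        dA k \<in> carrier_mat m m \<and> dC k \<in> carrier_mat m m \<and>
        dB k \<in> carrier_mat n n \<and> dD k \<in> carrier_mat n n \<and>
        dE k \<in> carrier_mat m n \<and> dF k \<in> carrier_mat m n \<and>
        (A k + dA k) * X k - Y k * (B k + dB k) = E k + dE k \<and>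
        (C k + dC k) * X (k + 1) - Y k * (D k + dD k) = F k + dF k \<and>
        frob_norm (dA k) \<le> \<epsilon> * \<alpha> k \<and>
        frob_norm (dB k) \<le> \<epsilon> * \<beta> k \<and>
        frob_norm (dE k) \<le> \<epsilon> * \<gamma> k \<and>
        frob_norm (dC k) \<le> \<epsilon> * \<zeta> k \<and>
        frob_norm (dD k) \<le> \<epsilon> * \<tau> k \<and>
        frob_norm (dF k) \<le> \<epsilon> * \<delta> k)"

definition backward_error ::
  "nat \<Rightarrow> nat \<Rightarrow> nat \<Rightarrow>
   (nat \<Rightarrow> real mat) \<Rightarrow> (nat \<Rightarrow> real mat) \<Rightarrow> (nat \<Rightarrow> real mat) \<Rightarrow>
   (nat \<Rightarrow> real mat) \<Rightarrow> (nat \<Rightarrow> real mat) \<Rightarrow> (nat \<Rightarrow> real mat) \<Rightarrow>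
   (nat \<Rightarrow> real) \<Rightarrow> (nat \<Rightarrow> real) \<Rightarrow> (nat \<Rightarrow> real) \<Rightarrow>
   (nat \<Rightarrow> real) \<Rightarrow> (nat \<Rightarrow> real) \<Rightarrow> (nat \<Rightarrow> real) \<Rightarrow>
   (nat \<Rightarrow> real mat) \<Rightarrow> (nat \<Rightarrow> real mat) \<Rightarrow> real" where
  "backward_error p m n A B C D E F \<alpha> \<beta> \<gamma> \<zeta> \<tau> \<delta> X Y =
     (LEAST \<epsilon>. backward_error_feasible p m n A B C D E F \<alpha> \<beta> \<gamma> \<zeta> \<tau> \<delta> X Y \<epsilon>)"

definition H_block ::
  "nat \<Rightarrow> nat \<Rightarrow>
   (nat \<Rightarrow> real) \<Rightarrow> (nat \<Rightarrow> real) \<Rightarrow> (nat \<Rightarrow> real) \<Rightarrow>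
   (nat \<Rightarrow> real) \<Rightarrow> (nat \<Rightarrow> real) \<Rightarrow> (nat \<Rightarrow> real) \<Rightarrow>
   (nat \<Rightarrow> real mat) \<Rightarrow> (nat \<Rightarrow> real mat) \<Rightarrow> nat \<Rightarrow> real mat" where
  "H_block m n \<alpha> \<beta> \<gamma> \<zeta> \<tau> \<delta> X Y k =
     block_row (m * n)
       [\<alpha> k \<cdot>\<^sub>m kronecker (transpose_mat (X k)) (1\<^sub>m m),
        (- \<beta> k) \<cdot>\<^sub>m kronecker (1\<^sub>m n) (Y k),
        (- \<gamma> k) \<cdot>\<^sub>m 1\<^sub>m (m * n),
        0\<^sub>m (m * n) (m * m), 0\<^sub>m (m * n) (n * n), 0\<^sub>m (m * n) (m * n)]
     @\<^sub>r
     block_row (m * n)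
       [0\<^sub>m (m * n) (m * m), 0\<^sub>m (m * n) (n * n), 0\<^sub>m (m * n) (m * n),
        \<zeta> k \<cdot>\<^sub>m kronecker (transpose_mat (X (k + 1))) (1\<^sub>m m),
        (- \<tau> k) \<cdot>\<^sub>m kronecker (1\<^sub>m n) (Y k),
        (- \<delta> k) \<cdot>\<^sub>m 1\<^sub>m (m * n)]"

definition H_matrix ::
  "nat \<Rightarrow> nat \<Rightarrow> nat \<Rightarrow>
   (nat \<Rightarrow> real) \<Rightarrow> (nat \<Rightarrow> real) \<Rightarrow> (nat \<Rightarrow> real) \<Rightarrow>
   (nat \<Rightarrow> real) \<Rightarrow> (nat \<Rightarrow> real) \<Rightarrow> (nat \<Rightarrow> real) \<Rightarrow>
   (nat \<Rightarrow> real mat) \<Rightarrow> (nat \<Rightarrow> real mat) \<Rightarrow> real mat" where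
  "H_matrix p m n \<alpha> \<beta> \<gamma> \<zeta> \<tau> \<delta> X Y =
     diag_block_mat (map (H_block m n \<alpha> \<beta> \<gamma> \<zeta> \<tau> \<delta> X Y) [1..<p + 1])"

definition residual_vec ::
  "nat \<Rightarrow> nat \<Rightarrow>
   (nat \<Rightarrow> real mat) \<Rightarrow> (nat \<Rightarrow> real mat) \<Rightarrow> (nat \<Rightarrow> real mat) \<Rightarrow>
   (nat \<Rightarrow> real mat) \<Rightarrow> (nat \<Rightarrow> real mat) \<Rightarrow> (nat \<Rightarrow> real mat) \<Rightarrow>
   (nat \<Rightarrow> real mat) \<Rightarrow> (nat \<Rightarrow> real mat) \<Rightarrow> real vec" where
  "residual_vec p m A B C D E F X Y =
     vectorize (block_row m (concat (map
       (\<lambda>k. [E k - (A k * X k - Y k * B k), F k - (C k * X (k + 1) - Y k * D k)])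
       [1..<p + 1])))"

end

(* Dividing every perturbation by its tolerance and stacking them into one vector z turns the
   perturbed equations into H z = r. A feasible epsilon bounds each of the 6p pieces of z, so
   |z| <= sqrt (6p) epsilon; conversely each piece is bounded by |z|, so |z| is feasible for every
   solution z. The blocks -gamma I and -delta I make H surjective, whence H H^T is invertible,
   the Moore-Penrose inverse is H^T (H H^T)^(-1), and it sends r to the solution of least norm.
   That the least feasible epsilon exists is a compactness argument. *)
theory Submission
  imports Defs "HOL-Analysis.Function_Topology" "Jordan_Normal_Form.Determinant"
begin

text \<open>Feasibility caps the largest of the scaled pieces, whereas the Moore-Penrose inverse
  minimises their joint Euclidean norm; the factor \<open>sqrt (6 * real p)\<close> between the two
  bounds is the comparison of these two norms. Two definitions by description shape the work.
  \<open>THE\<close> is informative only after existence and uniqueness of the Penrose inverse, and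
  \<open>LEAST\<close> on the reals only after the minimum is known to be attained, so attainment
  precedes both inequalities. The least-norm solution itself supplies a first feasible value, which
  confines the search to a bounded range of epsilon. Since the tolerances also bound the
  perturbations, only closedness of the constraints is left to check, and that is done entry by
  entry, jointly in epsilon and the perturbations.\<close>

section \<open>Moore-Penrose inverses of surjective matrices\<close>

lemma mult_mat_assoc_dim:
  fixes U V W :: "'a::semiring_0 mat"
  shows "dim_col U = dim_row V \<Longrightarrow> dim_col V = dim_row W \<Longrightarrow> U * V * W = U * (V * W)"
  by (rule assoc_mult_mat[of U "dim_row U" "dim_row V" V "dim_row W" W "dim_col W"]) auto

lemma eucl_norm_sq: "(eucl_norm v)\<^sup>2 = v \<bullet> v"
  by (simp add: eucl_norm_def scalar_prod_def sum_nonneg lessThan_atLeast0 power2_eq_square)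

lemma eucl_norm_nonneg: "0 \<le> eucl_norm v"
  by (simp add: eucl_norm_def sum_nonneg)

lemma scalar_prod_self_eq_0:
  fixes v :: "real vec"
  assumes "v \<in> carrier_vec k" "v \<bullet> v = 0"
  shows "v = 0\<^sub>v k"
  using assms by (auto simp: scalar_prod_def sum_nonneg_eq_0_iff)

text \<open>If M M^T y = 0 then |M^T y|^2 = 0, so y is orthogonal to the range of M; surjectivity
  makes that range the whole space, hence y = 0. Symmetry of \<open>G\<close> is inherited from M
  M^T.\<close>

lemma gram_inverse:
  fixes M :: "real mat"
  assumes M: "M \<in> carrier_mat r c"
    and surj: "\<And>y. y \<in> carrier_vec r \<Longrightarrow> \<exists>z\<in>carrier_vec c. M *\<^sub>v z = y"
  obtains G where "G \<in> carrier_mat r r" "(M * M\<^sup>T) * G = 1\<^sub>m r" "G\<^sup>T = G"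
proof -
  let ?S = "M * M\<^sup>T"
  have S: "?S \<in> carrier_mat r r" and MT: "M\<^sup>T \<in> carrier_mat c r" using M by auto
  have "det ?S \<noteq> 0"
  proof
    assume "det ?S = 0"
    then obtain y where y: "y \<in> carrier_vec r" "y \<noteq> 0\<^sub>v r" "?S *\<^sub>v y = 0\<^sub>v r"
      using det_0_iff_vec_prod_zero_field[OF S] by blast
    have MTy: "M\<^sup>T *\<^sub>v y \<in> carrier_vec c" using MT y by auto
    have "M *\<^sub>v (M\<^sup>T *\<^sub>v y) = 0\<^sub>v r" using y M MT by (simp add: assoc_mult_mat_vec)
    then have "(M\<^sup>T *\<^sub>v y) \<bullet> (M\<^sup>T *\<^sub>v y) = 0"
      using transpose_vec_mult_scalar[OF M MTy y(1)] y(1) by simp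
    then have 0: "M\<^sup>T *\<^sub>v y = 0\<^sub>v c" using scalar_prod_self_eq_0[OF MTy] by simp
    obtain z where z: "z \<in> carrier_vec c" "M *\<^sub>v z = y" using surj y(1) by blast
    \<comment> \<open>Writing one factor y as M z moves M to the other factor, where M^T y
      vanishes.\<close>
    have "y \<bullet> y = (M\<^sup>T *\<^sub>v y) \<bullet> z" using transpose_vec_mult_scalar[OF M z(1) y(1)] z by simp
    then have "y \<bullet> y = 0" using 0 z by simp
    then show False using scalar_prod_self_eq_0 y by blast
  qed
  then have "?S \<in> Units (ring_mat TYPE(real) r ())" by (rule det_non_zero_imp_unit[OF S])
  then obtain G where G: "G \<in> carrier_mat r r" "?S * G = 1\<^sub>m r"
    unfolding Units_def ring_mat_simps by auto
  have ST: "?S\<^sup>T = ?S" using M by (simp add: transpose_mult[OF M MT])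
  have GT: "G\<^sup>T \<in> carrier_mat r r" using G by simp
  have "G\<^sup>T = G\<^sup>T * (?S * G)" using G by simp
  also have "\<dots> = (G\<^sup>T * ?S\<^sup>T) * G" unfolding ST using G GT S by (simp add: assoc_mult_mat)
  also have "G\<^sup>T * ?S\<^sup>T = (?S * G)\<^sup>T" by (rule transpose_mult[OF S G(1), symmetric])
  also have "\<dots> * G = G" using G by (simp add: transpose_one)
  finally show ?thesis using that G by blast
qed

text \<open>A right inverse shortens the classical argument. \<open>Q\<close> is then a right
  inverse as well, so \<open>Q * M\<close> and \<open>P * M\<close> absorb each other: each product
  of the two equals its left factor. Both are symmetric, so transposing one product yields the other
  and forces equality.\<close>

lemma moore_penrose_inverse_unique:
  assumes M: "M \<in> carrier_mat r c"
    and P: "is_moore_penrose_inverse M P" and Q: "is_moore_penrose_inverse M Q"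
    and MP: "M * P = 1\<^sub>m r"
  shows "Q = P"
proof -
  have Pc: "P \<in> carrier_mat c r" and Qc: "Q \<in> carrier_mat c r"
    using P Q M by (auto simp: is_moore_penrose_inverse_def)
  have "M * Q * (M * P) = (M * Q * M) * P" using M Pc Qc by (simp add: mult_mat_assoc_dim)
  also have "M * Q * M = M" using Q by (simp add: is_moore_penrose_inverse_def)
  finally have MQ: "M * Q = 1\<^sub>m r" unfolding MP using right_mult_one_mat[OF mult_carrier_mat[OF M Qc]] by simp
  have PMc: "P * M \<in> carrier_mat c c" and QMc: "Q * M \<in> carrier_mat c c" using M Pc Qc by auto
  have aux: "U * M * (V * M) = U * M" if "M * V = 1\<^sub>m r" "U \<in> carrier_mat c r" "V \<in> carrier_mat c r" for U V
  proof -
    have "U * M * (V * M) = U * (M * (V * M))" using that M by (intro mult_mat_assoc_dim) auto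
    also have "M * (V * M) = M * V * M" using that M by (intro mult_mat_assoc_dim[symmetric]) auto
    finally show ?thesis using that M left_mult_one_mat[OF M] by simp
  qed
  have "Q * M = (Q * M)\<^sup>T" using Q by (simp add: is_moore_penrose_inverse_def)
  also have "\<dots> = (Q * M * (P * M))\<^sup>T" using aux[OF MP Qc Pc] by simp
  also have "\<dots> = (P * M)\<^sup>T * (Q * M)\<^sup>T" by (rule transpose_mult[OF QMc PMc])
  also have "\<dots> = P * M * (Q * M)" using P Q by (simp add: is_moore_penrose_inverse_def)
  also have "\<dots> = P * M" by (rule aux[OF MQ Pc Qc])
  finally have "Q * M = P * M" .
  then have "Q * M * P = P" using P by (simp add: is_moore_penrose_inverse_def)
  moreover have "Q * M * P = Q * (M * P)" using Pc Qc M by (intro mult_mat_assoc_dim) auto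
  ultimately show ?thesis unfolding MP right_mult_one_mat[OF Qc] by simp
qed

text \<open>The Penrose conditions follow from M P = 1 and the symmetry of P M = M^T G M. The
  factored form is exported because it places every value of the inverse in the range of M^T, which
  is what least norm rests on.\<close>

lemma moore_penrose_inverse_surj:
  assumes M: "M \<in> carrier_mat r c"
    and surj: "\<And>y. y \<in> carrier_vec r \<Longrightarrow> \<exists>z\<in>carrier_vec c. M *\<^sub>v z = y"
  obtains G where "G \<in> carrier_mat r r" "moore_penrose_inverse M = M\<^sup>T * G"
    "M * (M\<^sup>T * G) = 1\<^sub>m r"
proof -
  obtain G where G: "G \<in> carrier_mat r r" "(M * M\<^sup>T) * G = 1\<^sub>m r" "G\<^sup>T = G"
    using gram_inverse[OF M surj] by metis
  let ?P = "M\<^sup>T * G"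
  have MT: "M\<^sup>T \<in> carrier_mat c r" and Pc: "?P \<in> carrier_mat c r" using M G by auto
  have MP: "M * ?P = 1\<^sub>m r" using G M MT by (simp add: assoc_mult_mat)
  have "?P\<^sup>T = G * M" using transpose_mult[OF MT G(1)] G by simp
  then have "(?P * M)\<^sup>T = ?P * M"
    using transpose_mult[OF Pc M] M G MT by (simp add: assoc_mult_mat)
  moreover have "?P * M * ?P = ?P"
  proof -
    have "?P * M * ?P = ?P * (M * ?P)" using M G by (intro mult_mat_assoc_dim) auto
    then show ?thesis unfolding MP right_mult_one_mat[OF Pc] .
  qed
  ultimately have P: "is_moore_penrose_inverse M ?P"
    unfolding is_moore_penrose_inverse_def using MP M Pc by (simp add: transpose_one)
  have "moore_penrose_inverse M = ?P" unfolding moore_penrose_inverse_def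
    by (rule the_equality[where P = "is_moore_penrose_inverse M", OF P])
       (rule moore_penrose_inverse_unique[OF M P _ MP])
  then show ?thesis using that G MP by blast
qed

text \<open>Being in the range of M^T, \<open>z0\<close> is orthogonal to the kernel of M, hence to
  the difference of any two solutions. Pythagoras then gives |z|^2 - |z0|^2 = |z - z0|^2, which is
  nonnegative.\<close>

lemma moore_penrose_least_norm:
  assumes M: "M \<in> carrier_mat r c"
    and surj: "\<And>y. y \<in> carrier_vec r \<Longrightarrow> \<exists>z\<in>carrier_vec c. M *\<^sub>v z = y"
    and b: "b \<in> carrier_vec r"
  defines "z0 \<equiv> moore_penrose_inverse M *\<^sub>v b"
  shows "z0 \<in> carrier_vec c" "M *\<^sub>v z0 = b"
    and "\<And>z. z \<in> carrier_vec c \<Longrightarrow> M *\<^sub>v z = b \<Longrightarrow> eucl_norm z0 \<le> eucl_norm z"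
proof -
  obtain G where G: "G \<in> carrier_mat r r" and P: "moore_penrose_inverse M = M\<^sup>T * G"
    and MP: "M * (M\<^sup>T * G) = 1\<^sub>m r" using moore_penrose_inverse_surj[OF M surj] by metis
  have MT: "M\<^sup>T \<in> carrier_mat c r" using M by simp
  have Pc: "M\<^sup>T * G \<in> carrier_mat c r" using MT G by simp
  show z0: "z0 \<in> carrier_vec c" unfolding z0_def P using Pc b by auto
  have "M *\<^sub>v z0 = (M * (M\<^sup>T * G)) *\<^sub>v b" unfolding z0_def P by (rule assoc_mult_mat_vec[OF M Pc b, symmetric])
  then show Mz0: "M *\<^sub>v z0 = b" using MP b by simp
  have z0': "z0 = M\<^sup>T *\<^sub>v (G *\<^sub>v b)" unfolding z0_def P by (rule assoc_mult_mat_vec[OF MT G b])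
  have Gb: "G *\<^sub>v b \<in> carrier_vec r" using G b by auto
  fix z assume z: "z \<in> carrier_vec c" "M *\<^sub>v z = b"
  have "z0 \<bullet> z = z0 \<bullet> z0"
    using transpose_vec_mult_scalar[OF M z(1) Gb] transpose_vec_mult_scalar[OF M z0 Gb] Mz0 z(2)
    unfolding z0'[symmetric] by simp
  moreover have "(z - z0) \<bullet> (z - z0) = z \<bullet> z - 2 * (z0 \<bullet> z) + z0 \<bullet> z0"
    using z z0 by (simp add: minus_scalar_prod_distrib[of _ c] scalar_prod_minus_distrib[of _ c]
        comm_scalar_prod[of z c z0])
  moreover have "0 \<le> (z - z0) \<bullet> (z - z0)" by (simp add: eucl_norm_sq[symmetric])
  ultimately have "z0 \<bullet> z0 \<le> z \<bullet> z" by simp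
  then show "eucl_norm z0 \<le> eucl_norm z"
    using eucl_norm_sq eucl_norm_nonneg power2_le_imp_le by metis
qed

section \<open>Vectorization and block matrices\<close>

lemma sum_lessThan_mult:
  fixes f :: "nat \<Rightarrow> 'a::comm_monoid_add"
  shows "(\<Sum>l<a * b. f l) = (\<Sum>c<a. \<Sum>d<b. f (c * b + d))"
proof -
  have "sum f {c * b..<c * b + b} = (\<Sum>d<b. f (c * b + d))" for c
    using sum.shift_bounds_nat_ivl[of f 0 "c * b" b] by (simp add: lessThan_atLeast0 add.commute)
  then show ?thesis by (simp only: sum.nat_group[symmetric])
qed

lemma div_mod_mult_add [simp]:
  fixes a b c :: nat
  assumes "c < b"
  shows "(a * b + c) div b = a" "(a * b + c) mod b = c"
  using assms by auto

lemma less_mult_imp_div_mod_less: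
  fixes i :: nat
  assumes "i < a * b"
  shows "i div b < a" "i mod b < b"
proof -
  show "i div b < a" using assms by (simp add: less_mult_imp_div_less)
  show "i mod b < b" using assms by (cases "b = 0") auto
qed

text \<open>The classical vec identity. Under column stacking, position l of
  \<open>vectorize S\<close> holds row \<open>l mod b\<close> and column \<open>l div b\<close>, the
  same decoding that \<open>kronecker\<close> applies to its column index, so regrouping the sum by
  columns leaves the two nested sums of the product.\<close>

lemma kronecker_mult_vectorize:
  assumes P: "P \<in> carrier_mat a b" and S: "S \<in> carrier_mat b c" and Q: "Q \<in> carrier_mat c d"
  shows "kronecker Q\<^sup>T P *\<^sub>v vectorize S = vectorize (P * S * Q)"
proof (rule eq_vecI)
  show "dim_vec (kronecker Q\<^sup>T P *\<^sub>v vectorize S) = dim_vec (vectorize (P * S * Q))"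
    using assms by (simp add: kronecker_def vectorize_def)
next
  fix i assume "i < dim_vec (vectorize (P * S * Q))"
  then have i: "i < d * a" using assms by (simp add: vectorize_def mult.commute)
  note i' = less_mult_imp_div_mod_less[OF i]
  have "(kronecker Q\<^sup>T P *\<^sub>v vectorize S) $ i
      = (\<Sum>l<c * b. Q\<^sup>T $$ (i div a, l div b) * P $$ (i mod a, l mod b) * S $$ (l mod b, l div b))"
    using assms i by (simp add: kronecker_def vectorize_def scalar_prod_def lessThan_atLeast0 mult.commute[of b c])
  also have "\<dots> = (\<Sum>k<c. \<Sum>j<b. Q\<^sup>T $$ (i div a, k) * P $$ (i mod a, j) * S $$ (j, k))"
    unfolding sum_lessThan_mult by (intro sum.cong refl) simp
  also have "\<dots> = (\<Sum>k<c. (\<Sum>j<b. P $$ (i mod a, j) * S $$ (j, k)) * Q $$ (k, i div a))"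
    using Q i' by (intro sum.cong refl) (simp add: sum_distrib_right sum_distrib_left mult_ac)
  also have "\<dots> = vectorize (P * S * Q) $ i"
    using assms i i' by (simp add: vectorize_def scalar_prod_def lessThan_atLeast0 mult.commute[of a d]
        del: assoc_mult_mat)
  finally show "(kronecker Q\<^sup>T P *\<^sub>v vectorize S) $ i = vectorize (P * S * Q) $ i" .
qed

lemma vectorize_carrier [simp]: "A \<in> carrier_mat a b \<Longrightarrow> vectorize A \<in> carrier_vec (a * b)"
  by (auto simp: vectorize_def)

lemma eucl_norm_vectorize: "eucl_norm (vectorize A) = frob_norm A"
proof -
  have "(\<Sum>i<dim_row A * dim_col A. (vectorize A $ i)\<^sup>2)
      = (\<Sum>i<dim_col A * dim_row A. (A $$ (i mod dim_row A, i div dim_row A))\<^sup>2)"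
    by (intro sum.cong) (auto simp: vectorize_def mult.commute)
  also have "\<dots> = (\<Sum>j<dim_col A. \<Sum>i<dim_row A. (A $$ (i, j))\<^sup>2)"
    unfolding sum_lessThan_mult by (intro sum.cong refl) simp
  also have "\<dots> = (\<Sum>i<dim_row A. \<Sum>j<dim_col A. (A $$ (i, j))\<^sup>2)" by (rule sum.swap)
  finally show ?thesis by (simp add: eucl_norm_def frob_norm_def vectorize_def)
qed

lemma vectorize_surj:
  assumes v: "v \<in> carrier_vec (a * b)"
  obtains A where "A \<in> carrier_mat a b" "vectorize A = v"
proof
  let ?A = "mat a b (\<lambda>(i, j). v $ (j * a + i))"
  show "?A \<in> carrier_mat a b" by simp
  show "vectorize ?A = v"
  proof (rule eq_vecI)
    show "dim_vec (vectorize ?A) = dim_vec v" using v by (simp add: vectorize_def)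
    fix i assume "i < dim_vec v"
    then have i: "i < b * a" using v by (simp add: mult.commute)
    show "vectorize ?A $ i = v $ i" using i less_mult_imp_div_mod_less[OF i]
      by (simp add: vectorize_def mult.commute[of a b])
  qed
qed

lemma vectorize_inj:
  assumes A: "A \<in> carrier_mat a b" and B: "B \<in> carrier_mat a b" and eq: "vectorize A = vectorize B"
  shows "A = B"
proof (rule eq_matI)
  fix i j assume "i < dim_row B" "j < dim_col B"
  then have ij: "i < a" "j < b" using B by auto
  have "j * a + i < (j + 1) * a" using ij by simp
  also have "\<dots> \<le> b * a" using ij by (intro mult_right_mono) auto
  finally have "j * a + i < a * b" by (simp add: mult.commute)
  then show "A $$ (i, j) = B $$ (i, j)"
    using arg_cong[OF eq, of "\<lambda>v. v $ (j * a + i)"] A B ij by (simp add: vectorize_def)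
qed (use A B in auto)

text \<open>The scalars -1 and the bracketing to the right are the shape that the product with a
  block row takes once each tolerance has cancelled.\<close>

lemma vectorize_diff_diff:
  assumes "U \<in> carrier_mat a b" "V \<in> carrier_mat a b" "W \<in> carrier_mat a b"
  shows "vectorize (U - V - W) = vectorize U + (- 1 \<cdot>\<^sub>v vectorize V + - 1 \<cdot>\<^sub>v vectorize W)"
proof (rule eq_vecI)
  show "dim_vec (vectorize (U - V - W)) = dim_vec (vectorize U + (- 1 \<cdot>\<^sub>v vectorize V + - 1 \<cdot>\<^sub>v vectorize W))"
    using assms by (simp add: vectorize_def)
  fix i assume "i < dim_vec (vectorize U + (- 1 \<cdot>\<^sub>v vectorize V + - 1 \<cdot>\<^sub>v vectorize W))"
  then have "i < b * a" using assms by (simp add: vectorize_def mult.commute)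
  from less_mult_imp_div_mod_less[OF this] this
  show "vectorize (U - V - W) $ i
      = (vectorize U + (- 1 \<cdot>\<^sub>v vectorize V + - 1 \<cdot>\<^sub>v vectorize W)) $ i"
    using assms by (simp add: vectorize_def mult.commute[of b a])
qed

section \<open>Block rows, concatenated vectors and block diagonal matrices\<close>

lemma eucl_norm_append_sq: "(eucl_norm (v @\<^sub>v w))\<^sup>2 = (eucl_norm v)\<^sup>2 + (eucl_norm w)\<^sup>2"
  unfolding eucl_norm_sq
  by (rule scalar_prod_append[of _ "dim_vec v" _ "dim_vec w"]) auto

lemma append_cols_carrier [simp]:
  "A \<in> carrier_mat r a \<Longrightarrow> B \<in> carrier_mat r b \<Longrightarrow> append_cols A B \<in> carrier_mat r (a + b)"
  by (auto simp: append_cols_def)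

text \<open>Column stacking turns juxtaposition into appending: the first a columns fill exactly the
  first a * r positions, and a shift by a * r changes the column index by a and keeps the
  row.\<close>

lemma vectorize_append_cols:
  assumes A: "A \<in> carrier_mat r a" and B: "B \<in> carrier_mat r b"
  shows "vectorize (append_cols A B) = vectorize A @\<^sub>v vectorize B"
proof (rule eq_vecI)
  show "dim_vec (vectorize (append_cols A B)) = dim_vec (vectorize A @\<^sub>v vectorize B)"
    using assms by (simp add: vectorize_def append_cols_def algebra_simps)
  fix i assume "i < dim_vec (vectorize A @\<^sub>v vectorize B)"
  then have i: "i < (a + b) * r" using assms by (simp add: vectorize_def algebra_simps)
  note i' = less_mult_imp_div_mod_less[OF i]
  have lhs: "vectorize (append_cols A B) $ i =
      (if i div r < a then A $$ (i mod r, i div r) else B $$ (i mod r, i div r - a))"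
    using assms i i' by (simp add: vectorize_def append_cols_def mult.commute[of r])
  show "vectorize (append_cols A B) $ i = (vectorize A @\<^sub>v vectorize B) $ i"
  proof (cases "i < a * r")
    case True
    then have "i div r < a" by (rule less_mult_imp_div_mod_less)
    then show ?thesis unfolding lhs using True i A B by (simp add: vectorize_def algebra_simps)
  next
    case False
    then obtain l where l: "i = a * r + l" by (metis le_Suc_ex not_less)
    have "0 < r" using i'(2) by simp
    then have "i div r = a + l div r" "i mod r = l mod r" unfolding l by simp_all
    then show ?thesis unfolding lhs using i A B l by (simp add: vectorize_def algebra_simps)
  qed
qed

lemma append_cols_mult_vec:
  assumes A: "A \<in> carrier_mat r a" and B: "B \<in> carrier_mat r b"
    and v: "v \<in> carrier_vec a" and w: "w \<in> carrier_vec b"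
  shows "append_cols A B *\<^sub>v (v @\<^sub>v w) = A *\<^sub>v v + B *\<^sub>v w"
proof -
  \<comment> \<open>The lower half of the underlying \<open>four_block_mat\<close> has no rows, so
    it contributes an empty tail.\<close>
  have "append_cols A B *\<^sub>v (v @\<^sub>v w) = (A *\<^sub>v v + B *\<^sub>v w) @\<^sub>v (0\<^sub>m 0 a *\<^sub>v v + 0\<^sub>m 0 b *\<^sub>v w)"
    unfolding append_cols_def using assms
    by (subst four_block_mat_mult_vec[of A r a B b _ 0]) auto
  also have "\<dots> = A *\<^sub>v v + B *\<^sub>v w" using assms by (intro eq_vecI) auto
  finally show ?thesis .
qed

lemma block_row_Cons [simp]: "block_row r (A # As) = append_cols A (block_row r As)"
  and block_row_Nil [simp]: "block_row r [] = 0\<^sub>m r 0"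
  by (simp_all add: block_row_def)

text \<open>The vector counterpart of \<open>block_row\<close>: both fold from the right and end in
  an empty block, so products can be computed by parallel induction.\<close>

definition concat_vec :: "real vec list \<Rightarrow> real vec" where
  "concat_vec vs = foldr (@\<^sub>v) vs (0\<^sub>v 0)"

lemma concat_vec_simps [simp]:
  "concat_vec [] = 0\<^sub>v 0" "concat_vec (v # vs) = v @\<^sub>v concat_vec vs"
  by (simp_all add: concat_vec_def)

lemma concat_vec_carrier:
  "(\<And>k. k \<in> set ks \<Longrightarrow> w k \<in> carrier_vec (d k)) \<Longrightarrow>
    concat_vec (map w ks) \<in> carrier_vec (sum_list (map d ks))"
  by (induction ks) auto

lemma eucl_norm_concat_vec_sq:
  "(eucl_norm (concat_vec vs))\<^sup>2 = (\<Sum>v\<leftarrow>vs. (eucl_norm v)\<^sup>2)"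
  by (induction vs) (simp_all add: eucl_norm_append_sq, simp add: eucl_norm_def)

text \<open>Pieces are indexed by the elements of \<open>ks\<close> and not by positions;
  distinctness keeps one index from having to carry two different pieces.\<close>

lemma concat_vec_split:
  assumes "distinct ks" "v \<in> carrier_vec (sum_list (map d ks))"
  obtains w where "\<And>k. k \<in> set ks \<Longrightarrow> w k \<in> carrier_vec (d k)" "v = concat_vec (map w ks)"
  using assms
proof (induction ks arbitrary: v thesis)
  case Nil
  then have "v = concat_vec (map w [])" for w by (intro eq_vecI) auto
  then show ?case using Nil(1) by fastforce
next
  case (Cons k ks)
  define u where "u = vec_last v (sum_list (map d ks))"
  have v: "vec_first v (d k) @\<^sub>v u = v" using Cons.prems(3) by (simp add: u_def)
  have "u \<in> carrier_vec (sum_list (map d ks))" by (simp add: u_def)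
  then obtain w where w: "\<And>j. j \<in> set ks \<Longrightarrow> w j \<in> carrier_vec (d j)" "u = concat_vec (map w ks)"
    using Cons.IH Cons.prems(2) by auto
  let ?w = "w(k := vec_first v (d k))"
  have "map ?w ks = map w ks" using Cons.prems(2) by auto
  then have "concat_vec (map ?w (k # ks)) = vec_first v (d k) @\<^sub>v u"
    by (simp only: list.map concat_vec_simps fun_upd_same w(2))
  then have "v = concat_vec (map ?w (k # ks))" using v by simp
  moreover have "j \<in> set (k # ks) \<Longrightarrow> ?w j \<in> carrier_vec (d j)" for j using w(1) by auto
  ultimately show ?case using Cons.prems(1) by blast
qed

text \<open>Matching dimensions make the cuts of both sides fall at the same places, so equality can
  be read off piece by piece.\<close>

lemma concat_vec_eq_iff:
  assumes "\<And>k. k \<in> set ks \<Longrightarrow> dim_vec (u k) = dim_vec (w k)"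
  shows "concat_vec (map u ks) = concat_vec (map w ks) \<longleftrightarrow> (\<forall>k\<in>set ks. u k = w k)"
  using assms
proof (induction ks)
  case (Cons k ks)
  then have "u k \<in> carrier_vec (dim_vec (w k))" "w k \<in> carrier_vec (dim_vec (w k))"
    by (auto intro: carrier_vecI)
  from append_vec_eq[OF this] show ?case using Cons by simp
qed simp

lemma diag_block_mat_carrier:
  assumes "\<And>k. k \<in> set ks \<Longrightarrow> f k \<in> carrier_mat (a k) (b k)"
  shows "diag_block_mat (map f ks) \<in> carrier_mat (sum_list (map a ks)) (sum_list (map b ks))"
proof (rule carrier_matI)
  have *: "map (dim_row \<circ> f) ks = map a ks" "map (dim_col \<circ> f) ks = map b ks"
    using assms by (auto intro!: map_cong)
  show "dim_row (diag_block_mat (map f ks)) = sum_list (map a ks)"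
    "dim_col (diag_block_mat (map f ks)) = sum_list (map b ks)"
    unfolding dim_diag_block_mat map_map * by (rule refl)+
qed

lemma diag_block_mat_mult_concat_vec:
  assumes "\<And>k. k \<in> set ks \<Longrightarrow> f k \<in> carrier_mat (a k) (b k)"
    and "\<And>k. k \<in> set ks \<Longrightarrow> w k \<in> carrier_vec (b k)"
  shows "diag_block_mat (map f ks) *\<^sub>v concat_vec (map w ks) = concat_vec (map (\<lambda>k. f k *\<^sub>v w k) ks)"
  using assms
proof (induction ks)
  case Nil
  show ?case by (intro eq_vecI) simp_all
next
  case (Cons k ks)
  note D = diag_block_mat_carrier[of ks f a b, OF Cons.prems(1)]
  note W = concat_vec_carrier[of ks w b, OF Cons.prems(2)]
  have fk: "f k \<in> carrier_mat (a k) (b k)" and wk: "w k \<in> carrier_vec (b k)" using Cons.prems by auto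
  have "diag_block_mat (map f (k # ks)) = four_block_mat (f k)
      (0\<^sub>m (a k) (sum_list (map b ks))) (0\<^sub>m (sum_list (map a ks)) (b k)) (diag_block_mat (map f ks))"
    using fk carrier_matD[OF D] by (simp add: Let_def)
  moreover have "0\<^sub>m (a k) (sum_list (map b ks)) *\<^sub>v concat_vec (map w ks) = 0\<^sub>v (a k)"
    using W by (intro eq_vecI) auto
  moreover have "0\<^sub>m (sum_list (map a ks)) (b k) *\<^sub>v w k = 0\<^sub>v (sum_list (map a ks))"
    using wk by (intro eq_vecI) auto
  moreover have "f k *\<^sub>v w k \<in> carrier_vec (a k)"
    "diag_block_mat (map f ks) *\<^sub>v concat_vec (map w ks) \<in> carrier_vec (sum_list (map a ks))"
    using fk wk D W by auto
  ultimately show ?case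
    using four_block_mat_mult_vec[OF fk zero_carrier_mat zero_carrier_mat D wk W] Cons by simp
qed

lemma append_vec_assoc: "(u @\<^sub>v v) @\<^sub>v w = u @\<^sub>v v @\<^sub>v w"
  by (intro eq_vecI) auto

lemma smult_mat_mult_smult_vec:
  fixes a b :: "'a::comm_semiring_1"
  assumes "K \<in> carrier_mat r c" "x \<in> carrier_vec c"
  shows "(a \<cdot>\<^sub>m K) *\<^sub>v (b \<cdot>\<^sub>v x) = (a * b) \<cdot>\<^sub>v (K *\<^sub>v x)"
  using assms by (intro eq_vecI) (auto simp: scalar_prod_def sum_distrib_left mult_ac intro!: sum.cong)

lemma zero_mat_mult_vec: "v \<in> carrier_vec c \<Longrightarrow> 0\<^sub>m r c *\<^sub>v v = (0\<^sub>v r :: 'a::semiring_0 vec)"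
  by (intro eq_vecI) auto

lemma block_row_carrier_dim:
  assumes "list_all2 (\<lambda>A v. A \<in> carrier_mat r (dim_vec v)) As vs"
  shows "block_row r As \<in> carrier_mat r (dim_vec (concat_vec vs))"
  using assms by (induction rule: list_all2_induct) simp_all

text \<open>Kept as a fold, so that an explicit list simplifies to a sum nested to the right; its
  last summand is the zero vector coming from the empty block.\<close>

lemma block_row_mult_concat_vec:
  assumes "list_all2 (\<lambda>A v. A \<in> carrier_mat r (dim_vec v)) As vs"
  shows "block_row r As *\<^sub>v concat_vec vs = foldr (\<lambda>(A, v) s. A *\<^sub>v v + s) (zip As vs) (0\<^sub>v r)"
  using assms
proof (induction rule: list_all2_induct)
  case Nil
  show ?case by (intro eq_vecI) simp_all
next
  case (Cons A As v vs)
  have "block_row r (A # As) *\<^sub>v concat_vec (v # vs) = A *\<^sub>v v + block_row r As *\<^sub>v concat_vec vs"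
    unfolding block_row_Cons concat_vec_simps
    by (rule append_cols_mult_vec[OF Cons(1) block_row_carrier_dim[OF Cons(2)]]) (rule carrier_dim_vec[THEN iffD2], rule refl)+
  then show ?case using Cons(3) by simp
qed

lemma block_row_carrier:
  assumes "\<And>k. k \<in> set ks \<Longrightarrow> P k \<in> carrier_mat r (d k)" "\<And>k. k \<in> set ks \<Longrightarrow> Q k \<in> carrier_mat r (d k)"
  shows "block_row r (concat (map (\<lambda>k. [P k, Q k]) ks)) \<in> carrier_mat r (\<Sum>k\<leftarrow>ks. d k + d k)"
  using assms by (induction ks) (auto simp: add.assoc)

text \<open>Pairing the two residuals of one index matches the two block rows of the corresponding
  diagonal block of H.\<close>

lemma vectorize_block_row_pairs:
  assumes "\<And>k. k \<in> set ks \<Longrightarrow> P k \<in> carrier_mat r (d k)" "\<And>k. k \<in> set ks \<Longrightarrow> Q k \<in> carrier_mat r (d k)"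
  shows "vectorize (block_row r (concat (map (\<lambda>k. [P k, Q k]) ks)))
    = concat_vec (map (\<lambda>k. vectorize (P k) @\<^sub>v vectorize (Q k)) ks)"
  using assms
proof (induction ks)
  case Nil
  show ?case by (intro eq_vecI) (simp_all add: vectorize_def)
next
  case (Cons k ks)
  let ?R = "block_row r (concat (map (\<lambda>k. [P k, Q k]) ks))"
  have R: "?R \<in> carrier_mat r (\<Sum>k\<leftarrow>ks. d k + d k)" using Cons by (intro block_row_carrier) auto
  have PQ: "P k \<in> carrier_mat r (d k)" "Q k \<in> carrier_mat r (d k)" using Cons by auto
  have "vectorize (block_row r (concat (map (\<lambda>k. [P k, Q k]) (k # ks))))
      = vectorize (P k) @\<^sub>v vectorize (Q k) @\<^sub>v vectorize ?R"
    using vectorize_append_cols[OF PQ(1) append_cols_carrier[OF PQ(2) R]]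
      vectorize_append_cols[OF PQ(2) R] by simp
  also have "vectorize ?R = concat_vec (map (\<lambda>k. vectorize (P k) @\<^sub>v vectorize (Q k)) ks)"
    using Cons by simp
  finally show ?case by (simp only: append_vec_assoc list.map concat_vec_simps)
qed

section \<open>One diagonal block of H acting on scaled perturbations\<close>

text \<open>The scaling by the tolerances is the one built into the blocks of \<open>H_block\<close>, so that
  multiplying by such a block returns the unscaled left-hand sides.\<close>
definition scaled_pert :: "real \<Rightarrow> real \<Rightarrow> real \<Rightarrow> real \<Rightarrow> real \<Rightarrow> real \<Rightarrow>
    real mat \<Rightarrow> real mat \<Rightarrow> real mat \<Rightarrow> real mat \<Rightarrow> real mat \<Rightarrow> real mat \<Rightarrow> real vec" where
  "scaled_pert a b g z t d U V W U' V' W' =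
     concat_vec [(1 / a) \<cdot>\<^sub>v vectorize U, (1 / b) \<cdot>\<^sub>v vectorize V, (1 / g) \<cdot>\<^sub>v vectorize W,
       (1 / z) \<cdot>\<^sub>v vectorize U', (1 / t) \<cdot>\<^sub>v vectorize V', (1 / d) \<cdot>\<^sub>v vectorize W']"

text \<open>The number of columns of one diagonal block, bracketed like the nested appends so that
  the six pieces can be peeled off one after another.\<close>

definition pert_dim :: "nat \<Rightarrow> nat \<Rightarrow> nat" where
  "pert_dim m n = m * m + (n * n + (m * n + (m * m + (n * n + m * n))))"

lemma kronecker_carrier:
  "P \<in> carrier_mat a b \<Longrightarrow> Q \<in> carrier_mat c d \<Longrightarrow> kronecker P Q \<in> carrier_mat (a * c) (b * d)"
  by (auto simp: kronecker_def)

lemma scaled_pert_carrier: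
  assumes "U \<in> carrier_mat m m" "V \<in> carrier_mat n n" "W \<in> carrier_mat m n"
    "U' \<in> carrier_mat m m" "V' \<in> carrier_mat n n" "W' \<in> carrier_mat m n"
  shows "scaled_pert a b g z t d U V W U' V' W' \<in> carrier_vec (pert_dim m n)"
  using assms by (intro carrier_vecI) (auto simp: scaled_pert_def pert_dim_def vectorize_def)

text \<open>Each tolerance in the block meets its reciprocal in \<open>scaled_pert\<close>, and the
  vec identity turns the Kronecker blocks into products with \<open>X\<close> and \<open>Y\<close>.
  Size and product are proved together because they rest on the same dimension facts.\<close>

lemma H_block_carrier_mult:
  assumes X: "X k \<in> carrier_mat m n" "X (k + 1) \<in> carrier_mat m n" and Y: "Y k \<in> carrier_mat m n"
    and pos: "\<alpha> k > 0" "\<beta> k > 0" "\<gamma> k > 0" "\<zeta> k > 0" "\<tau> k > 0" "\<delta> k > 0"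
    and U: "U \<in> carrier_mat m m" "U' \<in> carrier_mat m m"
    and V: "V \<in> carrier_mat n n" "V' \<in> carrier_mat n n"
    and W: "W \<in> carrier_mat m n" "W' \<in> carrier_mat m n"
  shows "H_block m n \<alpha> \<beta> \<gamma> \<zeta> \<tau> \<delta> X Y k \<in> carrier_mat (m * n + m * n) (pert_dim m n)" (is "?H \<in> _")
    and "H_block m n \<alpha> \<beta> \<gamma> \<zeta> \<tau> \<delta> X Y k *\<^sub>v
        scaled_pert (\<alpha> k) (\<beta> k) (\<gamma> k) (\<zeta> k) (\<tau> k) (\<delta> k) U V W U' V' W'
      = vectorize (U * X k - Y k * V - W) @\<^sub>v vectorize (U' * X (k + 1) - Y k * V' - W')"
proof -
  let ?z = "scaled_pert (\<alpha> k) (\<beta> k) (\<gamma> k) (\<zeta> k) (\<tau> k) (\<delta> k) U V W U' V' W'"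
  let ?zs = "[(1 / \<alpha> k) \<cdot>\<^sub>v vectorize U, (1 / \<beta> k) \<cdot>\<^sub>v vectorize V, (1 / \<gamma> k) \<cdot>\<^sub>v vectorize W,
       (1 / \<zeta> k) \<cdot>\<^sub>v vectorize U', (1 / \<tau> k) \<cdot>\<^sub>v vectorize V', (1 / \<delta> k) \<cdot>\<^sub>v vectorize W']"
  let ?T = "[\<alpha> k \<cdot>\<^sub>m kronecker (transpose_mat (X k)) (1\<^sub>m m),
        (- \<beta> k) \<cdot>\<^sub>m kronecker (1\<^sub>m n) (Y k), (- \<gamma> k) \<cdot>\<^sub>m 1\<^sub>m (m * n),
        0\<^sub>m (m * n) (m * m), 0\<^sub>m (m * n) (n * n), 0\<^sub>m (m * n) (m * n)]"
  let ?B = "[0\<^sub>m (m * n) (m * m), 0\<^sub>m (m * n) (n * n), 0\<^sub>m (m * n) (m * n),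
        \<zeta> k \<cdot>\<^sub>m kronecker (transpose_mat (X (k + 1))) (1\<^sub>m m),
        (- \<tau> k) \<cdot>\<^sub>m kronecker (1\<^sub>m n) (Y k), (- \<delta> k) \<cdot>\<^sub>m 1\<^sub>m (m * n)]"
  have z: "?z \<in> carrier_vec (pert_dim m n)" using U V W by (intro scaled_pert_carrier)
  have z_def: "?z = concat_vec ?zs" by (simp add: scaled_pert_def)
  have vc: "vectorize U \<in> carrier_vec (m * m)" "vectorize V \<in> carrier_vec (n * n)" "vectorize W \<in> carrier_vec (m * n)"
    "vectorize U' \<in> carrier_vec (m * m)" "vectorize V' \<in> carrier_vec (n * n)" "vectorize W' \<in> carrier_vec (m * n)"
    using U V W by auto
  have KX: "kronecker (transpose_mat S) (1\<^sub>m m) \<in> carrier_mat (m * n) (m * m)" if "S \<in> carrier_mat m n" for S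
    using kronecker_carrier[of "transpose_mat S" n m "1\<^sub>m m" m m] that by (simp add: mult.commute[of n m])
  have KY: "kronecker (1\<^sub>m n) (Y k) \<in> carrier_mat (m * n) (n * n)"
    using kronecker_carrier[OF one_carrier_mat Y, of n] by (simp add: mult.commute[of n m])
  have T: "list_all2 (\<lambda>A v. A \<in> carrier_mat (m * n) (dim_vec v)) ?T ?zs"
    and B: "list_all2 (\<lambda>A v. A \<in> carrier_mat (m * n) (dim_vec v)) ?B ?zs"
    using KX[OF X(1)] KX[OF X(2)] KY vc by auto
  have dz: "dim_vec (concat_vec ?zs) = pert_dim m n" using carrier_vecD[OF z] unfolding z_def .
  note bT = block_row_carrier_dim[OF T, unfolded dz] block_row_mult_concat_vec[OF T]
    and bB = block_row_carrier_dim[OF B, unfolded dz] block_row_mult_concat_vec[OF B]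
  show "?H \<in> carrier_mat (m * n + m * n) (pert_dim m n)"
    unfolding H_block_def by (rule carrier_append_rows[OF bT(1) bB(1)])
  have kX: "kronecker (transpose_mat S) (1\<^sub>m m) *\<^sub>v vectorize M = vectorize (M * S)"
    if "S \<in> carrier_mat m n" "M \<in> carrier_mat m m" for S M
    using kronecker_mult_vectorize[OF one_carrier_mat that(2,1)] that by simp
  have kY: "kronecker (1\<^sub>m n) (Y k) *\<^sub>v vectorize M = vectorize (Y k * M)" if "M \<in> carrier_mat n n" for M
    using kronecker_mult_vectorize[OF Y that one_carrier_mat] that Y by (simp add: transpose_one)
  \<comment> \<open>One identity serves both block rows: the coefficients collapse to 1, -1 and
    -1.\<close>
  have comb: "(c \<cdot>\<^sub>m kronecker (transpose_mat S) (1\<^sub>m m)) *\<^sub>v ((1 / c) \<cdot>\<^sub>v vectorize M)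
      + (((- e) \<cdot>\<^sub>m kronecker (1\<^sub>m n) (Y k)) *\<^sub>v ((1 / e) \<cdot>\<^sub>v vectorize N)
      + ((- f) \<cdot>\<^sub>m 1\<^sub>m (m * n)) *\<^sub>v ((1 / f) \<cdot>\<^sub>v vectorize L)) = vectorize (M * S - Y k * N - L)"
    if "c > 0" "e > 0" "f > 0" "S \<in> carrier_mat m n" "M \<in> carrier_mat m m" "N \<in> carrier_mat n n" "L \<in> carrier_mat m n"
    for c e f :: real and S M N L
  proof -
    have "vectorize M \<in> carrier_vec (m * m)" "vectorize N \<in> carrier_vec (n * n)" "vectorize L \<in> carrier_vec (m * n)"
      using that by auto
    then show ?thesis using that Y kX[OF that(4,5)] kY[OF that(6)]
      by (simp add: smult_mat_mult_smult_vec[OF KX] smult_mat_mult_smult_vec[OF KY]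
          smult_mat_mult_smult_vec[OF one_carrier_mat] vectorize_diff_diff[of _ m n])
  qed
  have top: "block_row (m * n) ?T *\<^sub>v ?z = vectorize (U * X k - Y k * V - W)"
  proof -
    have "block_row (m * n) ?T *\<^sub>v ?z = (\<alpha> k \<cdot>\<^sub>m kronecker (transpose_mat (X k)) (1\<^sub>m m)) *\<^sub>v ((1 / \<alpha> k) \<cdot>\<^sub>v vectorize U)
      + (((- \<beta> k) \<cdot>\<^sub>m kronecker (1\<^sub>m n) (Y k)) *\<^sub>v ((1 / \<beta> k) \<cdot>\<^sub>v vectorize V)
      + (((- \<gamma> k) \<cdot>\<^sub>m 1\<^sub>m (m * n)) *\<^sub>v ((1 / \<gamma> k) \<cdot>\<^sub>v vectorize W) + 0\<^sub>v (m * n)))"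
      unfolding z_def bT(2) using vc by (simp add: zero_mat_mult_vec)
    also have "((- \<gamma> k) \<cdot>\<^sub>m 1\<^sub>m (m * n)) *\<^sub>v ((1 / \<gamma> k) \<cdot>\<^sub>v vectorize W) + 0\<^sub>v (m * n)
      = ((- \<gamma> k) \<cdot>\<^sub>m 1\<^sub>m (m * n)) *\<^sub>v ((1 / \<gamma> k) \<cdot>\<^sub>v vectorize W)" using vc
      by (intro right_zero_vec mult_mat_vec_carrier[of _ _ "m * n"]) auto
    finally show ?thesis using comb pos X U V W by simp
  qed
  have bot: "block_row (m * n) ?B *\<^sub>v ?z = vectorize (U' * X (k + 1) - Y k * V' - W')"
  proof -
    let ?t = "(\<zeta> k \<cdot>\<^sub>m kronecker (transpose_mat (X (k + 1))) (1\<^sub>m m)) *\<^sub>v ((1 / \<zeta> k) \<cdot>\<^sub>v vectorize U')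
      + (((- \<tau> k) \<cdot>\<^sub>m kronecker (1\<^sub>m n) (Y k)) *\<^sub>v ((1 / \<tau> k) \<cdot>\<^sub>v vectorize V')
      + ((- \<delta> k) \<cdot>\<^sub>m 1\<^sub>m (m * n)) *\<^sub>v ((1 / \<delta> k) \<cdot>\<^sub>v vectorize W'))"
    have *: "((- \<delta> k) \<cdot>\<^sub>m 1\<^sub>m (m * n)) *\<^sub>v ((1 / \<delta> k) \<cdot>\<^sub>v vectorize W') + 0\<^sub>v (m * n)
      = ((- \<delta> k) \<cdot>\<^sub>m 1\<^sub>m (m * n)) *\<^sub>v ((1 / \<delta> k) \<cdot>\<^sub>v vectorize W')" using vc
      by (intro right_zero_vec mult_mat_vec_carrier[of _ _ "m * n"]) auto
    have c: "?t = vectorize (U' * X (k + 1) - Y k * V' - W')" using comb pos X U V W by simp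
    have tc: "?t \<in> carrier_vec (m * n)" unfolding c using Y W by (intro vectorize_carrier) auto
    \<comment> \<open>Here the three zero blocks come first, so zero vectors pile up on the left; in
      the upper row they are absorbed at the end.\<close>
    have "block_row (m * n) ?B *\<^sub>v ?z = 0\<^sub>v (m * n) + (0\<^sub>v (m * n) + (0\<^sub>v (m * n) + ?t))"
      unfolding z_def bB(2) using vc * by (simp add: zero_mat_mult_vec)
    then show ?thesis using tc c by (simp only: left_zero_vec)
  qed
  show "?H *\<^sub>v ?z = vectorize (U * X k - Y k * V - W) @\<^sub>v vectorize (U' * X (k + 1) - Y k * V' - W')"
    unfolding H_block_def mat_mult_append[OF bT(1) bB(1) z] top bot ..
qed

lemma carrier_vec_split_append:
  assumes "v \<in> carrier_vec (a + b)"
  obtains u w where "u \<in> carrier_vec a" "w \<in> carrier_vec b" "v = u @\<^sub>v w"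
  using that[of "vec_first v a" "vec_last v b"] vec_first_last_append[OF assms] by simp

lemma smult_vectorize_surj:
  assumes "v \<in> carrier_vec (a * b)" and "c > 0"
  obtains M where "M \<in> carrier_mat a b" "v = (1 / c) \<cdot>\<^sub>v vectorize M"
proof -
  obtain M where M: "M \<in> carrier_mat a b" "vectorize M = c \<cdot>\<^sub>v v"
    using vectorize_surj[of "c \<cdot>\<^sub>v v" a b] assms by auto
  show ?thesis using that[OF M(1)] assms unfolding M(2) by (simp add: smult_smult_assoc)
qed

text \<open>Allows a solution of the linear system to be read back as perturbations: cut the vector
  into its six pieces, undo the scaling by the positive tolerances and reshape.\<close>

lemma scaled_pert_surj:
  assumes v: "v \<in> carrier_vec (pert_dim m n)"
    and pos: "a > 0" "b > 0" "g > 0" "z > 0" "t > 0" "d > 0"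
  obtains U V W U' V' W' where
    "U \<in> carrier_mat m m" "V \<in> carrier_mat n n" "W \<in> carrier_mat m n"
    "U' \<in> carrier_mat m m" "V' \<in> carrier_mat n n" "W' \<in> carrier_mat m n"
    "v = scaled_pert a b g z t d U V W U' V' W'"
proof -
  obtain v1 w1 where 1: "v1 \<in> carrier_vec (m * m)" "v = v1 @\<^sub>v w1"
    "w1 \<in> carrier_vec (n * n + (m * n + (m * m + (n * n + m * n))))"
    using v unfolding pert_dim_def by (rule carrier_vec_split_append)
  obtain v2 w2 where 2: "v2 \<in> carrier_vec (n * n)" "w1 = v2 @\<^sub>v w2"
    "w2 \<in> carrier_vec (m * n + (m * m + (n * n + m * n)))"
    using 1(3) by (rule carrier_vec_split_append)
  obtain v3 w3 where 3: "v3 \<in> carrier_vec (m * n)" "w2 = v3 @\<^sub>v w3"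
    "w3 \<in> carrier_vec (m * m + (n * n + m * n))"
    using 2(3) by (rule carrier_vec_split_append)
  obtain v4 w4 where 4: "v4 \<in> carrier_vec (m * m)" "w3 = v4 @\<^sub>v w4" "w4 \<in> carrier_vec (n * n + m * n)"
    using 3(3) by (rule carrier_vec_split_append)
  obtain v5 v6 where 5: "v5 \<in> carrier_vec (n * n)" "w4 = v5 @\<^sub>v v6" "v6 \<in> carrier_vec (m * n)"
    using 4(3) by (rule carrier_vec_split_append)
  obtain U where U: "U \<in> carrier_mat m m" "v1 = (1 / a) \<cdot>\<^sub>v vectorize U"
    using smult_vectorize_surj[OF 1(1) pos(1)] .
  obtain V where V: "V \<in> carrier_mat n n" "v2 = (1 / b) \<cdot>\<^sub>v vectorize V"
    using smult_vectorize_surj[OF 2(1) pos(2)] .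
  obtain W where W: "W \<in> carrier_mat m n" "v3 = (1 / g) \<cdot>\<^sub>v vectorize W"
    using smult_vectorize_surj[OF 3(1) pos(3)] .
  obtain U' where U': "U' \<in> carrier_mat m m" "v4 = (1 / z) \<cdot>\<^sub>v vectorize U'"
    using smult_vectorize_surj[OF 4(1) pos(4)] .
  obtain V' where V': "V' \<in> carrier_mat n n" "v5 = (1 / t) \<cdot>\<^sub>v vectorize V'"
    using smult_vectorize_surj[OF 5(1) pos(5)] .
  obtain W' where W': "W' \<in> carrier_mat m n" "v6 = (1 / d) \<cdot>\<^sub>v vectorize W'"
    using smult_vectorize_surj[OF 5(3) pos(6)] .
  \<comment> \<open>\<open>concat_vec\<close> closes with an empty vector, which the cutting above
    did not produce.\<close>
  have "v6 @\<^sub>v 0\<^sub>v 0 = v6" by (intro eq_vecI) auto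
  then have "v = scaled_pert a b g z t d U V W U' V' W'"
    unfolding scaled_pert_def using 1 2 3 4 5 U V W U' V' W' by simp
  then show ?thesis using that U V W U' V' W' by blast
qed

lemma eucl_norm_smult: "eucl_norm (c \<cdot>\<^sub>v v) = \<bar>c\<bar> * eucl_norm v"
  by (simp add: eucl_norm_def power_mult_distrib sum_distrib_left[symmetric] real_sqrt_mult)

lemma eucl_norm_scaled_pert_sq:
  assumes "a > 0" "b > 0" "g > 0" "z > 0" "t > 0" "d > 0"
  shows "(eucl_norm (scaled_pert a b g z t d U V W U' V' W'))\<^sup>2
    = (frob_norm U / a)\<^sup>2 + (frob_norm V / b)\<^sup>2 + (frob_norm W / g)\<^sup>2
    + (frob_norm U' / z)\<^sup>2 + (frob_norm V' / t)\<^sup>2 + (frob_norm W' / d)\<^sup>2"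
  unfolding scaled_pert_def eucl_norm_concat_vec_sq using assms
  by (simp add: eucl_norm_smult eucl_norm_vectorize)

text \<open>After distributing the products this is a rearrangement in each entry. The second family
  has the same form with \<open>C\<close>, \<open>D\<close>, \<open>F\<close> and
  \<open>X (k + 1)\<close>, so one lemma covers both.\<close>

lemma perturbed_eq_iff_residual:
  fixes A :: "real mat"
  assumes "A \<in> carrier_mat m m" "dA \<in> carrier_mat m m" "B \<in> carrier_mat n n" "dB \<in> carrier_mat n n"
    "E \<in> carrier_mat m n" "dE \<in> carrier_mat m n" "X \<in> carrier_mat m n" "Y \<in> carrier_mat m n"
  shows "(A + dA) * X - Y * (B + dB) = E + dE \<longleftrightarrow> dA * X - Y * dB - dE = E - (A * X - Y * B)"
proof -
  have *: "(A + dA) * X = A * X + dA * X" "Y * (B + dB) = Y * B + Y * dB"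
    using add_mult_distrib_mat[OF assms(1,2,7)] mult_add_distrib_mat[OF assms(8,3,4)] by auto
  have "A * X \<in> carrier_mat m n" "dA * X \<in> carrier_mat m n" "Y * B \<in> carrier_mat m n" "Y * dB \<in> carrier_mat m n"
    using assms by auto
  then have d: "dim_row (A * X) = m" "dim_row (dA * X) = m" "dim_row (Y * B) = m" "dim_row (Y * dB) = m"
    "dim_col (A * X) = n" "dim_col (dA * X) = n" "dim_col (Y * B) = n" "dim_col (Y * dB) = n"
    "dim_row E = m" "dim_row dE = m" "dim_col E = n" "dim_col dE = n"
    using assms by auto
  have gen: "P + P' - (Q + Q') = R + R' \<longleftrightarrow> P' - Q' - R' = R - (P - Q)"
    if "dim_row P = m" "dim_row P' = m" "dim_row Q = m" "dim_row Q' = m"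
    "dim_col P = n" "dim_col P' = n" "dim_col Q = n" "dim_col Q' = n"
    "dim_row R = m" "dim_row R' = m" "dim_col R = n" "dim_col R' = n" for P P' Q Q' R R' :: "real mat"
  proof -
    have "p + p' - (q + q') = r + r' \<longleftrightarrow> p' - q' - r' = r - (p - q)" for p p' q q' r r' :: real by argo
    then show ?thesis using that by (simp add: mat_eq_iff)
  qed
  show ?thesis unfolding * by (rule gen) (use d in simp_all)
qed

section \<open>The stacked perturbation vector\<close>

text \<open>Turns norm bounds into bounds on single coordinates, which place the perturbations in a
  compact box.\<close>

lemma abs_entry_le_frob_norm:
  assumes "i < dim_row A" "j < dim_col A"
  shows "\<bar>A $$ (i, j)\<bar> \<le> frob_norm A"
proof -
  have "(A $$ (i, j))\<^sup>2 \<le> (\<Sum>j<dim_col A. (A $$ (i, j))\<^sup>2)"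
    by (rule member_le_sum) (use assms in auto)
  also have "\<dots> \<le> (\<Sum>i<dim_row A. \<Sum>j<dim_col A. (A $$ (i, j))\<^sup>2)"
    by (rule member_le_sum[of i _ "\<lambda>i. \<Sum>j<dim_col A. (A $$ (i, j))\<^sup>2"]) (use assms in \<open>auto intro: sum_nonneg\<close>)
  finally show ?thesis unfolding frob_norm_def by (rule real_le_rsqrt[of "\<bar>_\<bar>", simplified])
qed

lemma frob_norm_nonneg: "0 \<le> frob_norm A"
  by (simp add: frob_norm_def sum_nonneg)

text \<open>Tychonoff's theorem. The index type may be infinite because function spaces carry the
  product topology.\<close>

lemma compact_PiE_Icc: "compact (PiE UNIV (\<lambda>_::'a. {- M..M::real}))"
proof -
  have "compactin (product_topology (\<lambda>_::'a. euclidean::real topology) UNIV) (PiE UNIV (\<lambda>_. {- M..M}))"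
    unfolding compactin_PiE by simp
  then show ?thesis unfolding euclidean_product_topology compactin_euclidean_iff .
qed

text \<open>Periodicity appears in the form in which the argument uses it: \<open>X (k + 1)\<close>
  has the right size for every index, including the last.\<close>

locale pgcs =
  fixes p m n :: nat
    and A B C D E F X Y :: "nat \<Rightarrow> real mat"
    and \<alpha> \<beta> \<gamma> \<zeta> \<tau> \<delta> :: "nat \<Rightarrow> real"
  assumes A: "\<And>k. k \<in> {1..p} \<Longrightarrow> A k \<in> carrier_mat m m"
    and C: "\<And>k. k \<in> {1..p} \<Longrightarrow> C k \<in> carrier_mat m m"
    and B: "\<And>k. k \<in> {1..p} \<Longrightarrow> B k \<in> carrier_mat n n"
    and D: "\<And>k. k \<in> {1..p} \<Longrightarrow> D k \<in> carrier_mat n n"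
    and E: "\<And>k. k \<in> {1..p} \<Longrightarrow> E k \<in> carrier_mat m n"
    and F: "\<And>k. k \<in> {1..p} \<Longrightarrow> F k \<in> carrier_mat m n"
    and X: "\<And>k. k \<in> {1..p} \<Longrightarrow> X k \<in> carrier_mat m n"
    and Y: "\<And>k. k \<in> {1..p} \<Longrightarrow> Y k \<in> carrier_mat m n"
    and X_Suc: "\<And>k. k \<in> {1..p} \<Longrightarrow> X (k + 1) \<in> carrier_mat m n"
    and pos: "\<And>k. k \<in> {1..p} \<Longrightarrow> \<alpha> k > 0 \<and> \<beta> k > 0 \<and> \<gamma> k > 0 \<and> \<zeta> k > 0 \<and> \<tau> k > 0 \<and> \<delta> k > 0"
begin

abbreviation "feasible \<equiv> backward_error_feasible p m n A B C D E F \<alpha> \<beta> \<gamma> \<zeta> \<tau> \<delta> X Y"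
abbreviation "H \<equiv> H_matrix p m n \<alpha> \<beta> \<gamma> \<zeta> \<tau> \<delta> X Y"
abbreviation "r \<equiv> residual_vec p m A B C D E F X Y"

text \<open>Feasibility is split into sizes, equations and norm bounds. Sizes alone allow stacking;
  the equations then become the linear system and the bounds concern the norm of the stacked
  vector.\<close>

definition admissible where
  "admissible dA dB dC dD dE dF \<longleftrightarrow> (\<forall>k\<in>{1..p}.
     dA k \<in> carrier_mat m m \<and> dB k \<in> carrier_mat n n \<and> dC k \<in> carrier_mat m m \<and>
     dD k \<in> carrier_mat n n \<and> dE k \<in> carrier_mat m n \<and> dF k \<in> carrier_mat m n)"

definition perturbed_solution where
  "perturbed_solution dA dB dC dD dE dF \<longleftrightarrow> (\<forall>k\<in>{1..p}.
     (A k + dA k) * X k - Y k * (B k + dB k) = E k + dE k \<and>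
     (C k + dC k) * X (k + 1) - Y k * (D k + dD k) = F k + dF k)"

text \<open>The arguments are in alphabetical order, whereas the pieces follow the columns of the
  diagonal block: A, B, E, then C, D, F.\<close>

definition block where
  "block dA dB dC dD dE dF k =
     scaled_pert (\<alpha> k) (\<beta> k) (\<gamma> k) (\<zeta> k) (\<tau> k) (\<delta> k) (dA k) (dB k) (dE k) (dC k) (dD k) (dF k)"

definition stack where
  "stack dA dB dC dD dE dF = concat_vec (map (block dA dB dC dD dE dF) [1..<p + 1])"

text \<open>The sizes stay sums over the index list, the form produced by the lemmas on
  concatenation and block diagonals.\<close>

abbreviation "N \<equiv> sum_list (map (\<lambda>_. pert_dim m n) [1..<p + 1])"
abbreviation "R \<equiv> sum_list (map (\<lambda>_. m * n + m * n) [1..<p + 1])"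

lemma set_upt_p: "set [1..<p + 1] = {1..p}"
  by auto

lemma block_carrier:
  assumes "admissible dA dB dC dD dE dF" "k \<in> {1..p}"
  shows "block dA dB dC dD dE dF k \<in> carrier_vec (pert_dim m n)"
  unfolding block_def by (rule scaled_pert_carrier) (use assms in \<open>auto simp: admissible_def\<close>)

lemma stack_carrier:
  assumes "admissible dA dB dC dD dE dF"
  shows "stack dA dB dC dD dE dF \<in> carrier_vec N"
  unfolding stack_def by (rule concat_vec_carrier) (use block_carrier[OF assms] in auto)

lemma H_block_carrier:
  assumes "k \<in> {1..p}"
  shows "H_block m n \<alpha> \<beta> \<gamma> \<zeta> \<tau> \<delta> X Y k \<in> carrier_mat (m * n + m * n) (pert_dim m n)"
  \<comment> \<open>Zero matrices stand in for the perturbations, which do not occur in the claim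
    about sizes.\<close>
  by (rule H_block_carrier_mult(1)[where X = X and Y = Y and k = k, OF X[OF assms] X_Suc[OF assms] Y[OF assms]
        _ _ _ _ _ _ zero_carrier_mat zero_carrier_mat zero_carrier_mat zero_carrier_mat zero_carrier_mat zero_carrier_mat])
    (use pos[OF assms] in auto)

lemma H_carrier: "H \<in> carrier_mat R N"
  unfolding H_matrix_def by (rule diag_block_mat_carrier) (use H_block_carrier in auto)

lemma H_mult_stack:
  assumes adm: "admissible dA dB dC dD dE dF"
  shows "H *\<^sub>v stack dA dB dC dD dE dF = concat_vec (map (\<lambda>k.
      vectorize (dA k * X k - Y k * dB k - dE k) @\<^sub>v
      vectorize (dC k * X (k + 1) - Y k * dD k - dF k)) [1..<p + 1])"
proof -
  have "H *\<^sub>v stack dA dB dC dD dE dF = concat_vec (map (\<lambda>k.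
      H_block m n \<alpha> \<beta> \<gamma> \<zeta> \<tau> \<delta> X Y k *\<^sub>v block dA dB dC dD dE dF k) [1..<p + 1])"
    unfolding H_matrix_def stack_def
    by (rule diag_block_mat_mult_concat_vec[where a = "\<lambda>_. m * n + m * n" and b = "\<lambda>_. pert_dim m n"])
      (use H_block_carrier block_carrier[OF adm] in auto)
  also have "\<dots> = concat_vec (map (\<lambda>k.
      vectorize (dA k * X k - Y k * dB k - dE k) @\<^sub>v
      vectorize (dC k * X (k + 1) - Y k * dD k - dF k)) [1..<p + 1])"
  proof (intro arg_cong[of _ _ concat_vec] map_cong refl)
    fix k assume "k \<in> set [1..<p + 1]"
    then have k: "k \<in> {1..p}" by auto
    show "H_block m n \<alpha> \<beta> \<gamma> \<zeta> \<tau> \<delta> X Y k *\<^sub>v block dA dB dC dD dE dF k =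
      vectorize (dA k * X k - Y k * dB k - dE k) @\<^sub>v vectorize (dC k * X (k + 1) - Y k * dD k - dF k)"
      unfolding block_def
      by (rule H_block_carrier_mult(2)[where X = X and Y = Y and k = k, OF X[OF k] X_Suc[OF k] Y[OF k]])
        (use pos[OF k] adm k in \<open>auto simp: admissible_def\<close>)
  qed
  finally show ?thesis .
qed

abbreviation "res1 k \<equiv> E k - (A k * X k - Y k * B k)"
abbreviation "res2 k \<equiv> F k - (C k * X (k + 1) - Y k * D k)"

lemma res_carrier:
  assumes "k \<in> {1..p}"
  shows "res1 k \<in> carrier_mat m n" "res2 k \<in> carrier_mat m n"
  using A B C D E F X Y X_Suc assms by (meson minus_carrier_mat mult_carrier_mat)+

lemma residual_vec_eq:
  "r = concat_vec (map (\<lambda>k. vectorize (res1 k) @\<^sub>v vectorize (res2 k)) [1..<p + 1])"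
  unfolding residual_vec_def
  by (rule vectorize_block_row_pairs[where d = "\<lambda>_. n"]) (use res_carrier in auto)

lemma residual_vec_carrier: "r \<in> carrier_vec R"
  unfolding residual_vec_eq
  by (rule concat_vec_carrier) (use res_carrier in \<open>auto intro!: append_carrier_vec vectorize_carrier\<close>)

text \<open>The linearisation behind both bounds. Blocks of equal length and injectivity of
  \<open>vectorize\<close> split the vector equation into the individual matrix equations.\<close>

lemma H_mult_stack_eq_residual_iff:
  assumes adm: "admissible dA dB dC dD dE dF"
  shows "H *\<^sub>v stack dA dB dC dD dE dF = r \<longleftrightarrow> perturbed_solution dA dB dC dD dE dF"
proof -
  let ?U = "\<lambda>k. dA k * X k - Y k * dB k - dE k"
  let ?V = "\<lambda>k. dC k * X (k + 1) - Y k * dD k - dF k"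
  have U: "?U k \<in> carrier_mat m n" and V: "?V k \<in> carrier_mat m n" if "k \<in> {1..p}" for k
    using adm that unfolding admissible_def by (meson minus_carrier_mat)+
  have "vectorize (?U k) @\<^sub>v vectorize (?V k) = vectorize (res1 k) @\<^sub>v vectorize (res2 k) \<longleftrightarrow>
      ?U k = res1 k \<and> ?V k = res2 k" if k: "k \<in> {1..p}" for k
    using append_vec_eq[OF vectorize_carrier[OF U[OF k]] vectorize_carrier[OF res_carrier(1)[OF k]]]
      vectorize_inj[OF U[OF k] res_carrier(1)[OF k]] vectorize_inj[OF V[OF k] res_carrier(2)[OF k]] by metis
  moreover have "dim_vec (vectorize (?U k) @\<^sub>v vectorize (?V k)) = dim_vec (vectorize (res1 k) @\<^sub>v vectorize (res2 k))"
    if k: "k \<in> {1..p}" for k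
    using carrier_matD[OF U[OF k]] carrier_matD[OF V[OF k]] carrier_matD[OF res_carrier(1)[OF k]] carrier_matD[OF res_carrier(2)[OF k]]
    by (simp only: vectorize_def dim_vec index_append_vec)
  ultimately have "H *\<^sub>v stack dA dB dC dD dE dF = r \<longleftrightarrow> (\<forall>k\<in>{1..p}. ?U k = res1 k \<and> ?V k = res2 k)"
    unfolding H_mult_stack[OF adm] residual_vec_eq
    by (subst concat_vec_eq_iff) (auto simp only: set_upt_p)
  also have "\<dots> \<longleftrightarrow> perturbed_solution dA dB dC dD dE dF"
    unfolding perturbed_solution_def
    using perturbed_eq_iff_residual[OF A _ B _ E _ X Y] perturbed_eq_iff_residual[OF C _ D _ F _ X_Suc Y] adm
    unfolding admissible_def by simp
  finally show ?thesis .
qed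

lemma stack_surj:
  assumes v: "v \<in> carrier_vec N"
  obtains dA dB dC dD dE dF where "admissible dA dB dC dD dE dF" "v = stack dA dB dC dD dE dF"
proof -
  obtain w where w: "\<And>k. k \<in> {1..p} \<Longrightarrow> w k \<in> carrier_vec (pert_dim m n)" "v = concat_vec (map w [1..<p + 1])"
    using concat_vec_split[OF distinct_upt v] unfolding set_upt_p by metis
  have "\<exists>U V W U' V' W'. U \<in> carrier_mat m m \<and> V \<in> carrier_mat n n \<and> W \<in> carrier_mat m n \<and>
    U' \<in> carrier_mat m m \<and> V' \<in> carrier_mat n n \<and> W' \<in> carrier_mat m n \<and>
    w k = scaled_pert (\<alpha> k) (\<beta> k) (\<gamma> k) (\<zeta> k) (\<tau> k) (\<delta> k) U V W U' V' W'" if "k \<in> {1..p}" for k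
    using scaled_pert_surj[OF w(1)[OF that]] pos[OF that] by metis
  then obtain dA dB dE dC dD dF where *: "\<forall>k\<in>{1..p}. dA k \<in> carrier_mat m m \<and> dB k \<in> carrier_mat n n \<and>
    dE k \<in> carrier_mat m n \<and> dC k \<in> carrier_mat m m \<and> dD k \<in> carrier_mat n n \<and> dF k \<in> carrier_mat m n \<and>
    w k = scaled_pert (\<alpha> k) (\<beta> k) (\<gamma> k) (\<zeta> k) (\<tau> k) (\<delta> k) (dA k) (dB k) (dE k) (dC k) (dD k) (dF k)"
    by metis
  have "map w [1..<p + 1] = map (block dA dB dC dD dE dF) [1..<p + 1]"
    by (rule map_cong) (use * in \<open>auto simp: block_def\<close>)
  then have "v = stack dA dB dC dD dE dF" unfolding stack_def w(2) by (rule arg_cong)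
  moreover have "admissible dA dB dC dD dE dF" unfolding admissible_def using * by blast
  ultimately show ?thesis by (intro that)
qed

text \<open>Perturbing only the right-hand sides reaches every target: with the other perturbations
  zero, the blocks of the product are -dE and -dF, so dE and dF are taken as the negated target
  blocks.\<close>

lemma H_surj:
  assumes y: "y \<in> carrier_vec R"
  shows "\<exists>z\<in>carrier_vec N. H *\<^sub>v z = y"
proof -
  obtain w where w: "\<And>k. k \<in> {1..p} \<Longrightarrow> w k \<in> carrier_vec (m * n + m * n)" "y = concat_vec (map w [1..<p + 1])"
    using concat_vec_split[OF distinct_upt y] unfolding set_upt_p by metis
  have "\<exists>S T. S \<in> carrier_mat m n \<and> T \<in> carrier_mat m n \<and> w k = vectorize S @\<^sub>v vectorize T"
    if "k \<in> {1..p}" for k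
    using carrier_vec_split_append[OF w(1)[OF that]] vectorize_surj by metis
  then obtain S T where ST: "\<And>k. k \<in> {1..p} \<Longrightarrow> S k \<in> carrier_mat m n" "\<And>k. k \<in> {1..p} \<Longrightarrow> T k \<in> carrier_mat m n"
    "\<And>k. k \<in> {1..p} \<Longrightarrow> w k = vectorize (S k) @\<^sub>v vectorize (T k)" by metis
  let ?Z = "\<lambda>a _::nat. 0\<^sub>m a a :: real mat"
  let ?z = "stack (?Z m) (?Z n) (?Z m) (?Z n) (\<lambda>k. - S k) (\<lambda>k. - T k)"
  have adm: "admissible (?Z m) (?Z n) (?Z m) (?Z n) (\<lambda>k. - S k) (\<lambda>k. - T k)"
    using ST by (simp add: admissible_def)
  have Z: "0\<^sub>m m m * P - Q * 0\<^sub>m n n - - U = U"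
    if "P \<in> carrier_mat m n" "Q \<in> carrier_mat m n" "U \<in> carrier_mat m n" for P Q U :: "real mat"
    using that by (intro eq_matI) auto
  have "H *\<^sub>v ?z = y"
    unfolding H_mult_stack[OF adm] w(2) using Z[OF X Y ST(1)] Z[OF X_Suc Y ST(2)] ST(3)
    by (intro arg_cong[of _ _ concat_vec] map_cong refl) auto
  then show ?thesis using stack_carrier[OF adm] by blast
qed

lemma eucl_norm_stack_sq:
  "(eucl_norm (stack dA dB dC dD dE dF))\<^sup>2
    = (\<Sum>k\<in>{1..p}. (frob_norm (dA k) / \<alpha> k)\<^sup>2 + (frob_norm (dB k) / \<beta> k)\<^sup>2 + (frob_norm (dE k) / \<gamma> k)\<^sup>2
        + (frob_norm (dC k) / \<zeta> k)\<^sup>2 + (frob_norm (dD k) / \<tau> k)\<^sup>2 + (frob_norm (dF k) / \<delta> k)\<^sup>2)"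
proof -
  have "(eucl_norm (stack dA dB dC dD dE dF))\<^sup>2 = (\<Sum>k\<in>{1..p}. (eucl_norm (block dA dB dC dD dE dF k))\<^sup>2)"
    unfolding stack_def eucl_norm_concat_vec_sq map_map o_def
    by (subst sum_list_distinct_conv_sum_set) (auto simp only: distinct_upt set_upt_p)
  also have "\<dots> = (\<Sum>k\<in>{1..p}. (frob_norm (dA k) / \<alpha> k)\<^sup>2 + (frob_norm (dB k) / \<beta> k)\<^sup>2 + (frob_norm (dE k) / \<gamma> k)\<^sup>2
        + (frob_norm (dC k) / \<zeta> k)\<^sup>2 + (frob_norm (dD k) / \<tau> k)\<^sup>2 + (frob_norm (dF k) / \<delta> k)\<^sup>2)"
    unfolding block_def by (intro sum.cong refl eucl_norm_scaled_pert_sq) (use pos in auto)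
  finally show ?thesis .
qed

text \<open>The source of the lower bound: the solution obtained here is later compared with the one
  of least norm.\<close>

lemma feasible_imp_stack:
  assumes "feasible e"
  obtains z where "z \<in> carrier_vec N" "H *\<^sub>v z = r" "eucl_norm z \<le> e * sqrt (6 * real p)"
proof -
  obtain dA dB dC dD dE dF where e: "0 \<le> e" and *: "\<forall>k\<in>{1..p}.
        dA k \<in> carrier_mat m m \<and> dC k \<in> carrier_mat m m \<and>
        dB k \<in> carrier_mat n n \<and> dD k \<in> carrier_mat n n \<and>
        dE k \<in> carrier_mat m n \<and> dF k \<in> carrier_mat m n \<and>
        (A k + dA k) * X k - Y k * (B k + dB k) = E k + dE k \<and>
        (C k + dC k) * X (k + 1) - Y k * (D k + dD k) = F k + dF k \<and>
        frob_norm (dA k) \<le> e * \<alpha> k \<and> frob_norm (dB k) \<le> e * \<beta> k \<and>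
        frob_norm (dE k) \<le> e * \<gamma> k \<and> frob_norm (dC k) \<le> e * \<zeta> k \<and>
        frob_norm (dD k) \<le> e * \<tau> k \<and> frob_norm (dF k) \<le> e * \<delta> k"
    using assms unfolding backward_error_feasible_def by blast
  let ?z = "stack dA dB dC dD dE dF"
  have adm: "admissible dA dB dC dD dE dF" using * by (simp add: admissible_def)
  have "perturbed_solution dA dB dC dD dE dF" using * by (simp add: perturbed_solution_def)
  then have Hz: "H *\<^sub>v ?z = r" using H_mult_stack_eq_residual_iff[OF adm] by blast
  have le: "(frob_norm M / c)\<^sup>2 \<le> e\<^sup>2" if "frob_norm M \<le> e * c" "c > 0" for M c
    using that frob_norm_nonneg[of M] by (intro power_mono) (auto simp: pos_divide_le_eq)
  have "(eucl_norm ?z)\<^sup>2 \<le> (\<Sum>k\<in>{1..p}. 6 * e\<^sup>2)"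
    unfolding eucl_norm_stack_sq
  proof (rule sum_mono)
    fix k assume k: "k \<in> {1..p}"
    have "(frob_norm (dA k) / \<alpha> k)\<^sup>2 \<le> e\<^sup>2" "(frob_norm (dB k) / \<beta> k)\<^sup>2 \<le> e\<^sup>2" "(frob_norm (dE k) / \<gamma> k)\<^sup>2 \<le> e\<^sup>2"
      "(frob_norm (dC k) / \<zeta> k)\<^sup>2 \<le> e\<^sup>2" "(frob_norm (dD k) / \<tau> k)\<^sup>2 \<le> e\<^sup>2" "(frob_norm (dF k) / \<delta> k)\<^sup>2 \<le> e\<^sup>2"
      using * pos[OF k] k by (intro le; blast)+
    then show "(frob_norm (dA k) / \<alpha> k)\<^sup>2 + (frob_norm (dB k) / \<beta> k)\<^sup>2 + (frob_norm (dE k) / \<gamma> k)\<^sup>2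
        + (frob_norm (dC k) / \<zeta> k)\<^sup>2 + (frob_norm (dD k) / \<tau> k)\<^sup>2 + (frob_norm (dF k) / \<delta> k)\<^sup>2 \<le> 6 * e\<^sup>2"
      by linarith
  qed
  also have "\<dots> = (e * sqrt (6 * real p))\<^sup>2" by (simp add: power_mult_distrib)
  finally have "eucl_norm ?z \<le> e * sqrt (6 * real p)" by (rule power2_le_imp_le) (use e in simp)
  then show ?thesis using that stack_carrier[OF adm] Hz by blast
qed

text \<open>The source of the upper bound, and of the existence of any feasible value: each scaled
  square is at most the whole sum of squares.\<close>

lemma feasible_eucl_norm:
  assumes z: "z \<in> carrier_vec N" and Hz: "H *\<^sub>v z = r"
  shows "feasible (eucl_norm z)"
proof -
  obtain dA dB dC dD dE dF where adm: "admissible dA dB dC dD dE dF" and z_eq: "z = stack dA dB dC dD dE dF"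
    using stack_surj[OF z] .
  have sol: "perturbed_solution dA dB dC dD dE dF" using H_mult_stack_eq_residual_iff[OF adm] Hz z_eq by blast
  have le: "frob_norm M \<le> eucl_norm z * c" if "(frob_norm M / c)\<^sup>2 \<le> (eucl_norm z)\<^sup>2" "c > 0" for M c
    using power2_le_imp_le[OF that(1) eucl_norm_nonneg] that(2) by (simp add: pos_divide_le_eq)
  have "frob_norm (dA k) \<le> eucl_norm z * \<alpha> k \<and> frob_norm (dB k) \<le> eucl_norm z * \<beta> k \<and>
        frob_norm (dE k) \<le> eucl_norm z * \<gamma> k \<and> frob_norm (dC k) \<le> eucl_norm z * \<zeta> k \<and>
        frob_norm (dD k) \<le> eucl_norm z * \<tau> k \<and> frob_norm (dF k) \<le> eucl_norm z * \<delta> k" if k: "k \<in> {1..p}" for k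
  proof -
    let ?f = "\<lambda>k. (frob_norm (dA k) / \<alpha> k)\<^sup>2 + (frob_norm (dB k) / \<beta> k)\<^sup>2 + (frob_norm (dE k) / \<gamma> k)\<^sup>2
        + (frob_norm (dC k) / \<zeta> k)\<^sup>2 + (frob_norm (dD k) / \<tau> k)\<^sup>2 + (frob_norm (dF k) / \<delta> k)\<^sup>2"
    have "?f k \<le> (eucl_norm z)\<^sup>2" unfolding z_eq eucl_norm_stack_sq
      by (rule member_le_sum[of k _ ?f, OF k]) auto
    moreover note zero_le_power2[of "frob_norm (dA k) / \<alpha> k"] zero_le_power2[of "frob_norm (dB k) / \<beta> k"]
      zero_le_power2[of "frob_norm (dE k) / \<gamma> k"] zero_le_power2[of "frob_norm (dC k) / \<zeta> k"]
      zero_le_power2[of "frob_norm (dD k) / \<tau> k"] zero_le_power2[of "frob_norm (dF k) / \<delta> k"]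
    ultimately show ?thesis using pos[OF k] by (intro conjI le; linarith)
  qed
  note norms = this
  show ?thesis
    unfolding backward_error_feasible_def
    by (rule conjI[OF eucl_norm_nonneg], rule exI[of _ dA], rule exI[of _ dB], rule exI[of _ dC],
        rule exI[of _ dD], rule exI[of _ dE], rule exI[of _ dF])
      (use norms adm sol in \<open>simp add: admissible_def perturbed_solution_def\<close>)
qed

end

section \<open>Attainment of the backward error\<close>

text \<open>With sizes fixed, equality is a finite conjunction over entries, so the set is an
  intersection of closed sets; continuity is required of entries only, and no topology on matrices
  is involved.\<close>

lemma closed_Collect_mat_eq:
  fixes f g :: "'a::topological_space \<Rightarrow> real mat"
  assumes f: "\<And>x. f x \<in> carrier_mat a b" and g: "\<And>x. g x \<in> carrier_mat a b"
    and cf: "\<And>i j. i < a \<Longrightarrow> j < b \<Longrightarrow> continuous_on UNIV (\<lambda>x. f x $$ (i, j))"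
    and cg: "\<And>i j. i < a \<Longrightarrow> j < b \<Longrightarrow> continuous_on UNIV (\<lambda>x. g x $$ (i, j))"
  shows "closed {x. f x = g x}"
proof -
  have "f x = g x \<longleftrightarrow> (\<forall>i j. i < a \<and> j < b \<longrightarrow> f x $$ (i, j) = g x $$ (i, j))" for x
    using carrier_matD[OF f] carrier_matD[OF g] by (auto simp: mat_eq_iff)
  then have "{x. f x = g x} = (\<Inter>i\<in>{..<a}. \<Inter>j\<in>{..<b}. {x. f x $$ (i, j) = g x $$ (i, j)})" by auto
  also have "closed \<dots>" by (intro closed_INT ballI closed_Collect_eq) (auto intro: cf cg)
  finally show ?thesis .
qed

lemma continuous_on_mult_mat_entry:
  fixes f g :: "'a::topological_space \<Rightarrow> real mat"
  assumes f: "\<And>x. f x \<in> carrier_mat a b" and g: "\<And>x. g x \<in> carrier_mat b c"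
    and cf: "\<And>i j. i < a \<Longrightarrow> j < b \<Longrightarrow> continuous_on UNIV (\<lambda>x. f x $$ (i, j))"
    and cg: "\<And>i j. i < b \<Longrightarrow> j < c \<Longrightarrow> continuous_on UNIV (\<lambda>x. g x $$ (i, j))"
    and "i < a" "j < c"
  shows "continuous_on UNIV (\<lambda>x. (f x * g x) $$ (i, j))"
proof -
  have "(f x * g x) $$ (i, j) = (\<Sum>l<b. f x $$ (i, l) * g x $$ (l, j))" for x
    using carrier_matD[OF f] carrier_matD[OF g] assms(5,6) by (simp add: scalar_prod_def lessThan_atLeast0)
  then show ?thesis using assms(5,6) by (auto intro!: continuous_on_sum continuous_on_mult cf cg)
qed

lemma continuous_on_add_mat_entry:
  fixes f g :: "'a::topological_space \<Rightarrow> real mat"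
  assumes f: "\<And>x. f x \<in> carrier_mat a b" and g: "\<And>x. g x \<in> carrier_mat a b"
    and cf: "continuous_on UNIV (\<lambda>x. f x $$ (i, j))" and cg: "continuous_on UNIV (\<lambda>x. g x $$ (i, j))"
    and "i < a" "j < b"
  shows "continuous_on UNIV (\<lambda>x. (f x + g x) $$ (i, j))"
    and "continuous_on UNIV (\<lambda>x. (f x - g x) $$ (i, j))"
proof -
  have "(f x + g x) $$ (i, j) = f x $$ (i, j) + g x $$ (i, j)"
    "(f x - g x) $$ (i, j) = f x $$ (i, j) - g x $$ (i, j)" for x
    using carrier_matD[OF f] carrier_matD[OF g] assms(5,6) by simp_all
  then show "continuous_on UNIV (\<lambda>x. (f x + g x) $$ (i, j))"
    and "continuous_on UNIV (\<lambda>x. (f x - g x) $$ (i, j))"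
    using cf cg by (simp_all add: continuous_on_add continuous_on_diff)
qed

lemma closed_perturbed_eq:
  fixes dA dB dE :: "'a::topological_space \<Rightarrow> real mat"
  assumes c: "A \<in> carrier_mat m m" "B \<in> carrier_mat n n" "E \<in> carrier_mat m n" "X \<in> carrier_mat m n" "Y \<in> carrier_mat m n"
    and d: "\<And>x. dA x \<in> carrier_mat m m" "\<And>x. dB x \<in> carrier_mat n n" "\<And>x. dE x \<in> carrier_mat m n"
    and cA: "\<And>i j. i < m \<Longrightarrow> j < m \<Longrightarrow> continuous_on UNIV (\<lambda>x. dA x $$ (i, j))"
    and cB: "\<And>i j. i < n \<Longrightarrow> j < n \<Longrightarrow> continuous_on UNIV (\<lambda>x. dB x $$ (i, j))"
    and cE: "\<And>i j. i < m \<Longrightarrow> j < n \<Longrightarrow> continuous_on UNIV (\<lambda>x. dE x $$ (i, j))"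
  shows "closed {x. (A + dA x) * X - Y * (B + dB x) = E + dE x}"
proof -
  have s: "A + dA x \<in> carrier_mat m m" "B + dB x \<in> carrier_mat n n" "E + dE x \<in> carrier_mat m n" for x
    using c d by auto
  have p: "(A + dA x) * X \<in> carrier_mat m n" "Y * (B + dB x) \<in> carrier_mat m n" for x
    using mult_carrier_mat[OF s(1) c(4)] mult_carrier_mat[OF c(5) s(2)] by auto
  have 1: "continuous_on UNIV (\<lambda>x. (A + dA x) $$ (i, j))" if "i < m" "j < m" for i j
    by (rule continuous_on_add_mat_entry(1)[OF c(1) d(1) continuous_on_const cA]) (use that in auto)
  have 2: "continuous_on UNIV (\<lambda>x. (B + dB x) $$ (i, j))" if "i < n" "j < n" for i j
    by (rule continuous_on_add_mat_entry(1)[OF c(2) d(2) continuous_on_const cB]) (use that in auto)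
  have 3: "continuous_on UNIV (\<lambda>x. (E + dE x) $$ (i, j))" if "i < m" "j < n" for i j
    by (rule continuous_on_add_mat_entry(1)[OF c(3) d(3) continuous_on_const cE]) (use that in auto)
  have 4: "continuous_on UNIV (\<lambda>x. ((A + dA x) * X) $$ (i, j))" if "i < m" "j < n" for i j
    by (rule continuous_on_mult_mat_entry[OF s(1) c(4) 1 continuous_on_const]) (use that in auto)
  have 5: "continuous_on UNIV (\<lambda>x. (Y * (B + dB x)) $$ (i, j))" if "i < m" "j < n" for i j
    by (rule continuous_on_mult_mat_entry[OF c(5) s(2) continuous_on_const 2]) (use that in auto)
  show ?thesis
    by (rule closed_Collect_mat_eq[OF minus_carrier_mat[OF p(2)] s(3)
          continuous_on_add_mat_entry(2)[OF p 4 5] 3])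
qed

section \<open>Compactness of the feasible perturbations\<close>

context pgcs
begin

text \<open>The slots \<open>0, \<dots>, 5\<close> stand for the perturbations of \<open>A, B, E, C, D, F\<close>, in this order.\<close>
definition pert_rows :: "nat \<Rightarrow> nat" where "pert_rows q = [m, n, m, m, n, m] ! q"
definition pert_cols :: "nat \<Rightarrow> nat" where "pert_cols q = [m, n, n, m, n, n] ! q"
definition tolerance :: "nat \<Rightarrow> nat \<Rightarrow> real" where
  "tolerance q k = [\<alpha> k, \<beta> k, \<gamma> k, \<zeta> k, \<tau> k, \<delta> k] ! q"

definition solves :: "(nat \<Rightarrow> nat \<Rightarrow> real mat) \<Rightarrow> nat \<Rightarrow> bool" where
  "solves d k \<longleftrightarrow> (A k + d 0 k) * X k - Y k * (B k + d 1 k) = E k + d 2 k \<and>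
     (C k + d 3 k) * X (k + 1) - Y k * (D k + d 4 k) = F k + d 5 k"

lemma all_less_6: "(\<forall>q<6. P q) \<longleftrightarrow> P 0 \<and> P 1 \<and> P 2 \<and> P 3 \<and> P 4 \<and> P (5::nat)"
proof -
  have "{..<6::nat} = {0, 1, 2, 3, 4, 5}" by auto
  moreover have "(\<forall>q<6. P q) \<longleftrightarrow> (\<forall>q\<in>{..<6}. P q)" by (simp only: Ball_def lessThan_iff)
  ultimately show ?thesis by simp
qed

text \<open>Replaces six named families by one family with a slot index, so that sizes, bounds and
  closedness are handled uniformly.\<close>

lemma feasible_iff:
  "feasible e \<longleftrightarrow> 0 \<le> e \<and> (\<exists>d. \<forall>k\<in>{1..p}. solves d k \<and>
     (\<forall>q<6. d q k \<in> carrier_mat (pert_rows q) (pert_cols q) \<and> frob_norm (d q k) \<le> e * tolerance q k))"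
  (is "_ \<longleftrightarrow> 0 \<le> e \<and> (\<exists>d. ?S d)")
proof
  assume "feasible e"
  then obtain dA dB dC dD dE dF where "0 \<le> e" and *: "\<forall>k\<in>{1..p}.
        dA k \<in> carrier_mat m m \<and> dC k \<in> carrier_mat m m \<and>
        dB k \<in> carrier_mat n n \<and> dD k \<in> carrier_mat n n \<and>
        dE k \<in> carrier_mat m n \<and> dF k \<in> carrier_mat m n \<and>
        (A k + dA k) * X k - Y k * (B k + dB k) = E k + dE k \<and>
        (C k + dC k) * X (k + 1) - Y k * (D k + dD k) = F k + dF k \<and>
        frob_norm (dA k) \<le> e * \<alpha> k \<and> frob_norm (dB k) \<le> e * \<beta> k \<and>
        frob_norm (dE k) \<le> e * \<gamma> k \<and> frob_norm (dC k) \<le> e * \<zeta> k \<and>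
        frob_norm (dD k) \<le> e * \<tau> k \<and> frob_norm (dF k) \<le> e * \<delta> k"
    unfolding backward_error_feasible_def by blast
  moreover have "?S (\<lambda>q k. [dA k, dB k, dE k, dC k, dD k, dF k] ! q)"
    using * unfolding all_less_6 solves_def pert_rows_def pert_cols_def tolerance_def by simp
  ultimately show "0 \<le> e \<and> (\<exists>d. ?S d)" by blast
next
  assume "0 \<le> e \<and> (\<exists>d. ?S d)"
  then obtain d where "0 \<le> e" "?S d" by blast
  \<comment> \<open>The existential quantifiers run through A, B, C, D, E, F, which sit in slots 0,
    1, 3, 4, 2, 5.\<close>
  show "feasible e"
    unfolding backward_error_feasible_def
    by (rule conjI[OF \<open>0 \<le> e\<close>], rule exI[of _ "d 0"], rule exI[of _ "d 1"], rule exI[of _ "d 3"],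
        rule exI[of _ "d 4"], rule exI[of _ "d 2"], rule exI[of _ "d 5"])
      (use \<open>?S d\<close> in \<open>simp add: all_less_6 solves_def pert_rows_def pert_cols_def tolerance_def\<close>)
qed

text \<open>All perturbations are read off a single real function on index tuples, so that compactness
  comes from Tychonoff's theorem on a product of intervals.\<close>
definition decode :: "(nat \<times> nat \<times> nat \<times> nat \<Rightarrow> real) \<Rightarrow> nat \<Rightarrow> nat \<Rightarrow> real mat" where
  "decode f q k = mat (pert_rows q) (pert_cols q) (\<lambda>(i, j). f (q, k, i, j))"

text \<open>Entries of decoded matrices are coordinate projections, continuous in the product
  topology, and both sides of each equation are built from them by sums and products.\<close>

lemma closed_solves:
  assumes k: "k \<in> {1..p}"
  shows "closed {x :: real \<times> (nat \<times> nat \<times> nat \<times> nat \<Rightarrow> real). solves (decode (snd x)) k}"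
proof -
  have cont: "continuous_on UNIV (\<lambda>x :: real \<times> (nat \<times> nat \<times> nat \<times> nat \<Rightarrow> real). decode (snd x) q k $$ (i, j))"
    if "i < pert_rows q" "j < pert_cols q" for q i j
    using that by (simp add: decode_def continuous_on_product_then_coordinatewise continuous_on_snd)
  have car: "decode f q k \<in> carrier_mat (pert_rows q) (pert_cols q)" for f q
    by (simp add: decode_def)
  have dims: "pert_rows 0 = m" "pert_cols 0 = m" "pert_rows 1 = n" "pert_cols 1 = n" "pert_rows 2 = m" "pert_cols 2 = n"
    "pert_rows 3 = m" "pert_cols 3 = m" "pert_rows 4 = n" "pert_cols 4 = n" "pert_rows 5 = m" "pert_cols 5 = n"
    by (simp_all add: pert_rows_def pert_cols_def)
  note car0 = car[of _ 0, unfolded dims] and car1 = car[of _ 1, unfolded dims] and car2 = car[of _ 2, unfolded dims]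
    and car3 = car[of _ 3, unfolded dims] and car4 = car[of _ 4, unfolded dims] and car5 = car[of _ 5, unfolded dims]
  note cont0 = cont[of _ 0, unfolded dims] and cont1 = cont[of _ 1, unfolded dims] and cont2 = cont[of _ 2, unfolded dims]
    and cont3 = cont[of _ 3, unfolded dims] and cont4 = cont[of _ 4, unfolded dims] and cont5 = cont[of _ 5, unfolded dims]
  show ?thesis unfolding solves_def
    by (intro closed_Collect_conj
        closed_perturbed_eq[OF A[OF k] B[OF k] E[OF k] X[OF k] Y[OF k] car0 car1 car2 cont0 cont1 cont2]
        closed_perturbed_eq[OF C[OF k] D[OF k] F[OF k] X_Suc[OF k] Y[OF k] car3 car4 car5 cont3 cont4 cont5])
qed

text \<open>Epsilon is the first coordinate of the point and varies with the perturbations;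
  closedness has to be joint, since the minimum is taken over pairs.\<close>

lemma closed_frob_norm_le:
  "closed {x :: real \<times> (nat \<times> nat \<times> nat \<times> nat \<Rightarrow> real). frob_norm (decode (snd x) q k) \<le> fst x * c}"
proof -
  have "frob_norm (decode f q k) = sqrt (\<Sum>i<pert_rows q. \<Sum>j<pert_cols q. (f (q, k, i, j))\<^sup>2)" for f
    by (simp add: frob_norm_def decode_def)
  then show ?thesis
    by (simp only:) (intro closed_Collect_le continuous_intros
        continuous_on_product_then_coordinatewise[OF continuous_on_snd[OF continuous_on_id]])
qed

text \<open>Pairs of epsilon and perturbations satisfying all constraints form a closed set. Cutting
  at the known value \<open>e1\<close> makes it compact, and the first projection attains its
  minimum there.\<close>

lemma least_feasible:
  assumes e1: "feasible e1"
  obtains e0 where "feasible e0" "\<And>e. feasible e \<Longrightarrow> e0 \<le> e"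
proof -
  \<comment> \<open>A crude common bound: the sum of all tolerances dominates each one, so
    \<open>M\<close> dominates every permitted norm as long as epsilon is at most
    \<open>e1\<close>.\<close>
  define M where "M = e1 * (\<Sum>k\<in>{1..p}. \<Sum>q<6. tolerance q k)"
  have e1_nonneg: "0 \<le> e1" using e1 by (simp add: feasible_iff)
  have tol_pos: "\<forall>q<6. 0 < tolerance q k" if "k \<in> {1..p}" for k
    unfolding all_less_6 using pos[OF that] by (simp add: tolerance_def)
  have tol_le: "e * tolerance q k \<le> M" if "0 \<le> e" "e \<le> e1" "k \<in> {1..p}" "q < 6" for e q k
  proof -
    have "tolerance q k \<le> (\<Sum>q<6. tolerance q k)"
      by (rule member_le_sum[of q _ "\<lambda>q. tolerance q k"]) (use tol_pos[OF that(3)] that(4) in \<open>auto simp: less_imp_le\<close>)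
    also have "\<dots> \<le> (\<Sum>k\<in>{1..p}. \<Sum>q<6. tolerance q k)"
      by (rule member_le_sum[of k _ "\<lambda>k. \<Sum>q<6. tolerance q k"])
        (use tol_pos that(3) in \<open>auto intro!: sum_nonneg simp: less_imp_le\<close>)
    finally show ?thesis unfolding M_def using that tol_pos[OF that(3)] by (intro mult_mono) (auto simp: less_imp_le)
  qed
  have M_nonneg: "0 \<le> M" unfolding M_def using e1_nonneg tol_pos
    by (intro mult_nonneg_nonneg sum_nonneg) (auto simp: less_imp_le)
  define K where "K = {0..e1} \<times> PiE UNIV (\<lambda>_::nat \<times> nat \<times> nat \<times> nat. {- M..M})"
  define S where "S = (\<Inter>k\<in>{1..p}. {x. solves (decode (snd x)) k} \<inter>
      (\<Inter>q\<in>{..<6}. {x. frob_norm (decode (snd x) q k) \<le> fst x * tolerance q k}))"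
  have "closed S" unfolding S_def using closed_solves closed_frob_norm_le
    by (intro closed_INT closed_Int ballI) auto
  then have comp: "compact (K \<inter> S)" unfolding K_def
    by (intro compact_Int_closed compact_Times compact_PiE_Icc) auto
  have encode: "\<exists>f. (e, f) \<in> K \<inter> S" if e: "feasible e" "e \<le> e1" for e
  proof -
    obtain d where "0 \<le> e" and d: "\<And>k. k \<in> {1..p} \<Longrightarrow> solves d k"
      "\<And>k q. k \<in> {1..p} \<Longrightarrow> q < 6 \<Longrightarrow> d q k \<in> carrier_mat (pert_rows q) (pert_cols q)"
      "\<And>k q. k \<in> {1..p} \<Longrightarrow> q < 6 \<Longrightarrow> frob_norm (d q k) \<le> e * tolerance q k"
      using e(1) unfolding feasible_iff by blast
    \<comment> \<open>Coordinates outside the meaningful index range are set to 0, which lies in the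
      box because \<open>M\<close> is nonnegative.\<close>
    define f where "f = (\<lambda>(q, k, i, j). if k \<in> {1..p} \<and> q < 6 \<and> i < pert_rows q \<and> j < pert_cols q
        then d q k $$ (i, j) else 0)"
    have dec: "decode f q k = d q k" if "k \<in> {1..p}" "q < 6" for q k
      using d(2)[OF that] that by (intro eq_matI) (auto simp: decode_def f_def)
    have "\<bar>f (q, k, i, j)\<bar> \<le> M" for q k i j
    proof (cases "k \<in> {1..p} \<and> q < 6 \<and> i < pert_rows q \<and> j < pert_cols q")
      case True
      then have k: "k \<in> {1..p}" and q: "q < 6" by auto
      have "\<bar>d q k $$ (i, j)\<bar> \<le> frob_norm (d q k)"
        by (rule abs_entry_le_frob_norm) (use True carrier_matD[OF d(2)[OF k q]] in auto)
      then show ?thesis using True d(3)[OF k q] tol_le[OF \<open>0 \<le> e\<close> e(2) k q] by (simp add: f_def)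
    qed (use M_nonneg in \<open>auto simp: f_def\<close>)
    then have "f \<in> PiE UNIV (\<lambda>_. {- M..M})" by (auto simp: abs_le_iff minus_le_iff)
    then have "(e, f) \<in> K" unfolding K_def using \<open>0 \<le> e\<close> e(2) by auto
    moreover have "(e, f) \<in> S" unfolding S_def using d(1,3) dec by (simp add: solves_def)
    ultimately show ?thesis by blast
  qed
  have decode: "feasible (fst x)" if "x \<in> K \<inter> S" for x
    unfolding feasible_iff using that by (intro conjI exI[of _ "decode (snd x)"]) (auto simp: K_def S_def decode_def[of "snd x"])
  have "K \<inter> S \<noteq> {}" using encode[OF e1] by blast
  from continuous_attains_inf[OF comp this continuous_on_fst[OF continuous_on_id]]
  obtain x where x: "x \<in> K \<inter> S" "\<And>y. y \<in> K \<inter> S \<Longrightarrow> fst x \<le> fst y" by auto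
  \<comment> \<open>Values above \<open>e1\<close> are not represented in the compact set, but its
    minimiser is at most \<open>e1\<close> anyway.\<close>
  have "fst x \<le> e" if "feasible e" for e
  proof (cases "e \<le> e1")
    case True
    then show ?thesis using encode[OF that] x(2) by force
  next
    case False
    then show ?thesis using x(1) by (auto simp: K_def)
  qed
  then show ?thesis using that decode[OF x(1)] by blast
qed

section \<open>The two-sided bound\<close>

lemma backward_error_bounds:
  defines "s \<equiv> eucl_norm (moore_penrose_inverse H *\<^sub>v r)"
    and "\<eta> \<equiv> backward_error p m n A B C D E F \<alpha> \<beta> \<gamma> \<zeta> \<tau> \<delta> X Y"
  assumes "p \<ge> 1"
  shows "s / sqrt (6 * real p) \<le> \<eta> \<and> \<eta> \<le> s"
proof -
  note z0 = moore_penrose_least_norm[OF H_carrier _ residual_vec_carrier]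
  \<comment> \<open>The least-norm solution plays two parts: it starts the compactness argument and
    it gives the upper bound.\<close>
  have s: "feasible s" unfolding s_def by (intro feasible_eucl_norm z0(1,2) H_surj)
  obtain e0 where e0: "feasible e0" "\<And>e. feasible e \<Longrightarrow> e0 \<le> e" using least_feasible[OF s] by blast
  have \<eta>: "\<eta> = e0" unfolding \<eta>_def backward_error_def using e0 by (rule Least_equality)
  obtain z where z: "z \<in> carrier_vec N" "H *\<^sub>v z = r" "eucl_norm z \<le> e0 * sqrt (6 * real p)"
    using feasible_imp_stack[OF e0(1)] .
  have "s \<le> eucl_norm z" unfolding s_def by (rule z0(3)[OF _ z(1,2)]) (rule H_surj)
  then have "s \<le> e0 * sqrt (6 * real p)" using z(3) by linarith
  then show ?thesis using e0(2)[OF s] assms(3) unfolding \<eta> by (simp add: pos_divide_le_eq)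
qed

end

theorem mainTheorem1:
  fixes p m n :: nat
    and A B C D E F :: "nat \<Rightarrow> real mat"
    and X Y :: "nat \<Rightarrow> real mat"
    and \<alpha> \<beta> \<gamma> \<zeta> \<tau> \<delta> :: "nat \<Rightarrow> real"
  assumes "p \<ge> 1" and "m \<ge> 1" and "n \<ge> 1"
    and "\<And>k. k \<in> {1..p} \<Longrightarrow> A k \<in> carrier_mat m m"
    and "\<And>k. k \<in> {1..p} \<Longrightarrow> C k \<in> carrier_mat m m"
    and "\<And>k. k \<in> {1..p} \<Longrightarrow> B k \<in> carrier_mat n n"
    and "\<And>k. k \<in> {1..p} \<Longrightarrow> D k \<in> carrier_mat n n"
    and "\<And>k. k \<in> {1..p} \<Longrightarrow> E k \<in> carrier_mat m n"
    and "\<And>k. k \<in> {1..p} \<Longrightarrow> F k \<in> carrier_mat m n"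
    and "\<And>k. k \<in> {1..p} \<Longrightarrow> X k \<in> carrier_mat m n"
    and "\<And>k. k \<in> {1..p} \<Longrightarrow> Y k \<in> carrier_mat m n"
    and "X (p + 1) = X 1"
    and "\<And>k. k \<in> {1..p} \<Longrightarrow> \<alpha> k > 0 \<and> \<beta> k > 0 \<and> \<gamma> k > 0 \<and> \<zeta> k > 0 \<and> \<tau> k > 0 \<and> \<delta> k > 0"
  shows "eucl_norm (moore_penrose_inverse (H_matrix p m n \<alpha> \<beta> \<gamma> \<zeta> \<tau> \<delta> X Y)
             *\<^sub>v residual_vec p m A B C D E F X Y) / sqrt (6 * real p)
           \<le> backward_error p m n A B C D E F \<alpha> \<beta> \<gamma> \<zeta> \<tau> \<delta> X Y
       \<and> backward_error p m n A B C D E F \<alpha> \<beta> \<gamma> \<zeta> \<tau> \<delta> X Y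
           \<le> eucl_norm (moore_penrose_inverse (H_matrix p m n \<alpha> \<beta> \<gamma> \<zeta> \<tau> \<delta> X Y)
             *\<^sub>v residual_vec p m A B C D E F X Y)"
proof -
  \<comment> \<open>For k = p the index leaves the given range, and periodicity sends it back to
    \<open>X 1\<close>.\<close>
  have X_Suc: "X (k + 1) \<in> carrier_mat m n" if "k \<in> {1..p}" for k
    using assms(1,10,12) that by (cases "k = p") auto
  interpret pgcs p m n A B C D E F X Y \<alpha> \<beta> \<gamma> \<zeta> \<tau> \<delta>
    by unfold_locales (fact assms X_Suc)+
  show ?thesis using assms(1) by (rule backward_error_bounds)
qed

end
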